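(* For any $\xi \in \mathbb{R}\setminus\mathbb{Q}$ we have $$\tau'''(\xi) = \tau''(\xi) = \tau'(\xi) = \tau(\xi) = \frac{1}{\mu(\xi)-1} \in [0,1]$$ (with $\frac{1}{\mu(\xi)-1} = 0$ when $\mu(\xi) = +\infty$). In particular the following assertions are equivalent: $\tau'''(\xi) = 0$; $\tau''(\xi) = 0$; $\tau'(\xi) = 0$; $\tau(\xi) = 0$; $\xi$ is a Liouville number.
   Context: For irrational $\xi$, $\mu(\xi)$ is the irrationality exponent: the infimum of all real $\mu$ such that $|\xi - p/q| > q^{-\mu}$ for all integers $p,q$ with $q$ sufficiently large (possibly $+\infty$). $\xi$ is a Liouville number if for every $\mu>0$ there is a rational $p/q$ with $|\xi - p/q| < q^{-\mu}$. Below, "$x_n = y_n^{a + o(1)}$" (resp. "$\le$") means $x_n = y_n^{a+\delta_n}$ (resp. $x_n \le y_n^{a+\delta_n}$) for some real sequence $\delta_n \to 0$ as $n\to\infty$. Define: (1) $\mathcal{T}(\xi)$: the set of $\tau>0$ for which there exist integer sequences $(u_n),(v_n)$ with $u_n\ne 0$ for all $n$, $u_n\xi - v_n \to 0$, $|u_{n+1}\xi - v_{n+1}| = |u_n\xi - v_n|^{1+o(1)}$, and $|u_n\xi - v_n| \le |u_n|^{-\tau+o(1)}$. (2) $\mathcal{T}'(\xi)$: the set of $\tau>0$ for which there exist integer sequences $(u_n),(v_n)$ and reals $0<\alpha<1<\beta$ with $|u_n\xi - v_n|^{1/n}\to\alpha$, $\limsup_n |u_n|^{1/n} \le \beta$,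 and $\tau = -\log\alpha/\log\beta$. (3) $\mathcal{T}''(\xi)$: the set of $\tau>0$ such that for every increasing sequence $(Q_n)$ of positive integers there exist integer sequences $(u_n),(v_n)$ with $|u_n| \le Q_n^{1+o(1)}$ and $|u_n\xi - v_n| = Q_n^{-\tau+o(1)}$. (4) $\mathcal{T}'''(\xi)$: the set of $\tau>0$ such that for all sequences $(Q_n),(\varepsilon_n)$ of positive reals with $Q_n\to+\infty$, $\varepsilon_n \to 0$ and $\varepsilon_n \ge Q_n^{-\tau+o(1)}$, there exist integer sequences $(u_n),(v_n)$ with $\lim_n u_n/Q_n = \lim_n (u_n\xi - v_n)/\varepsilon_n = 1$. Set $\tau(\xi) = \sup\mathcal{T}(\xi)$, $\tau'(\xi) = \sup\mathcal{T}'(\xi)$, $\tau''(\xi) = \sup\mathcal{T}''(\xi)$, $\tau'''(\xi) = \sup\mathcal{T}'''(\xi)$, with the convention $\sup\emptyset = 0$.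
   Formalization: In the definition of a Liouville number the rational p/q is required to have denominator q ≥ 2, because with q = 1 allowed every real number would satisfy the condition. *)

theory Defs
  imports Complex_Main "HOL-Library.Extended_Real" "HOL-Library.Liminf_Limsup"
begin

text \<open>
  Real powers whose exponent is a constant up to a null sequence: \<open>x\<^sub>n = y\<^sub>n\<close>, \<open>x\<^sub>n \<le> y\<^sub>n\<close> and
  \<open>x\<^sub>n \<ge> y\<^sub>n\<close> to the power \<open>a + o(1)\<close>. All bases below are positive (for
  irrational \<open>\<xi>\<close>), so \<open>powr\<close> is the usual power.
\<close>

definition pow_o1_eq :: "(nat \<Rightarrow> real) \<Rightarrow> (nat \<Rightarrow> real) \<Rightarrow> real \<Rightarrow> bool" where
  "pow_o1_eq x y a \<longleftrightarrow> (\<exists>\<delta>. \<delta> \<longlonglongrightarrow> 0 \<and> (\<forall>n. x n = y n powr (a + \<delta> n)))"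

definition pow_o1_le :: "(nat \<Rightarrow> real) \<Rightarrow> (nat \<Rightarrow> real) \<Rightarrow> real \<Rightarrow> bool" where
  "pow_o1_le x y a \<longleftrightarrow> (\<exists>\<delta>. \<delta> \<longlonglongrightarrow> 0 \<and> (\<forall>n. x n \<le> y n powr (a + \<delta> n)))"

definition pow_o1_ge :: "(nat \<Rightarrow> real) \<Rightarrow> (nat \<Rightarrow> real) \<Rightarrow> real \<Rightarrow> bool" where
  "pow_o1_ge x y a \<longleftrightarrow> (\<exists>\<delta>. \<delta> \<longlonglongrightarrow> 0 \<and> (\<forall>n. x n \<ge> y n powr (a + \<delta> n)))"

text \<open>The infimum is taken in the extended reals, so it is \<open>\<infinity>\<close> if no exponent qualifies.\<close>

definition irrationality_exponent :: "real \<Rightarrow> ereal" where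
  "irrationality_exponent \<xi> =
     Inf (ereal ` {m. \<exists>q0::int. \<forall>p q::int. q \<ge> q0 \<longrightarrow>
            \<bar>\<xi> - real_of_int p / real_of_int q\<bar> > real_of_int q powr (- m)})"

text \<open>
  Denominators are at least 2: allowing \<open>q = 1\<close> would make the condition hold for every real
  number.
\<close>

definition Liouville_number :: "real \<Rightarrow> bool" where
  "Liouville_number \<xi> \<longleftrightarrow>
     (\<forall>m::real. m > 0 \<longrightarrow> (\<exists>p q::int. q \<ge> 2 \<and>
        \<bar>\<xi> - real_of_int p / real_of_int q\<bar> < real_of_int q powr (- m)))"

definition T0_set :: "real \<Rightarrow> real set" where
  "T0_set \<xi> = {\<tau>. \<tau> > 0 \<and> (\<exists>u v :: nat \<Rightarrow> int.
      (\<forall>n. u n \<noteq> 0) \<and>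
      (\<lambda>n. real_of_int (u n) * \<xi> - real_of_int (v n)) \<longlonglongrightarrow> 0 \<and>
      pow_o1_eq (\<lambda>n. \<bar>real_of_int (u (Suc n)) * \<xi> - real_of_int (v (Suc n))\<bar>)
                (\<lambda>n. \<bar>real_of_int (u n) * \<xi> - real_of_int (v n)\<bar>) 1 \<and>
      pow_o1_le (\<lambda>n. \<bar>real_of_int (u n) * \<xi> - real_of_int (v n)\<bar>)
                (\<lambda>n. \<bar>real_of_int (u n)\<bar>) (- \<tau>))}"

definition T1_set :: "real \<Rightarrow> real set" where
  "T1_set \<xi> = {\<tau>. \<tau> > 0 \<and> (\<exists>(u :: nat \<Rightarrow> int) (v :: nat \<Rightarrow> int) (\<alpha>::real) (\<beta>::real).
      0 < \<alpha> \<and> \<alpha> < 1 \<and> 1 < \<beta> \<and>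
      (\<lambda>n. root n \<bar>real_of_int (u n) * \<xi> - real_of_int (v n)\<bar>) \<longlonglongrightarrow> \<alpha> \<and>
      limsup (\<lambda>n. ereal (root n \<bar>real_of_int (u n)\<bar>)) \<le> ereal \<beta> \<and>
      \<tau> = - ln \<alpha> / ln \<beta>)}"

text \<open>
  Increasing means strictly increasing. With constant sequences such as \<open>Q\<^sub>n = 2\<close> admitted,
  only countably many \<open>\<tau>\<close> could qualify and the supremum would lose its meaning.
\<close>

definition T2_set :: "real \<Rightarrow> real set" where
  "T2_set \<xi> = {\<tau>. \<tau> > 0 \<and> (\<forall>Q :: nat \<Rightarrow> nat. strict_mono Q \<and> (\<forall>n. Q n > 0) \<longrightarrow>
      (\<exists>u v :: nat \<Rightarrow> int.
        pow_o1_le (\<lambda>n. \<bar>real_of_int (u n)\<bar>) (\<lambda>n. real (Q n)) 1 \<and>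
        pow_o1_eq (\<lambda>n. \<bar>real_of_int (u n) * \<xi> - real_of_int (v n)\<bar>) (\<lambda>n. real (Q n)) (- \<tau>)))}"

definition T3_set :: "real \<Rightarrow> real set" where
  "T3_set \<xi> = {\<tau>. \<tau> > 0 \<and> (\<forall>Q \<epsilon> :: nat \<Rightarrow> real.
      (\<forall>n. Q n > 0) \<and> (\<forall>n. \<epsilon> n > 0) \<and>
      filterlim Q at_top sequentially \<and> \<epsilon> \<longlonglongrightarrow> 0 \<and> pow_o1_ge \<epsilon> Q (- \<tau>) \<longrightarrow>
      (\<exists>u v :: nat \<Rightarrow> int.
        (\<lambda>n. real_of_int (u n) / Q n) \<longlonglongrightarrow> 1 \<and>
        (\<lambda>n. (real_of_int (u n) * \<xi> - real_of_int (v n)) / \<epsilon> n) \<longlonglongrightarrow> 1))}"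

text \<open>
  Suprema in the extended reals, but with \<open>sup \<emptyset> = 0\<close> instead of \<open>-\<infinity>\<close>.
  The digit in a name counts the primes: \<open>tau0\<close> is \<open>\<tau>\<close>, \<open>tau3\<close> is \<open>\<tau>'''\<close>.
\<close>

definition sup0 :: "real set \<Rightarrow> ereal" where
  "sup0 S = (if S = {} then 0 else Sup (ereal ` S))"

definition tau0 :: "real \<Rightarrow> ereal" where "tau0 \<xi> = sup0 (T0_set \<xi>)"
definition tau1 :: "real \<Rightarrow> ereal" where "tau1 \<xi> = sup0 (T1_set \<xi>)"
definition tau2 :: "real \<Rightarrow> ereal" where "tau2 \<xi> = sup0 (T2_set \<xi>)"
definition tau3 :: "real \<Rightarrow> ereal" where "tau3 \<xi> = sup0 (T3_set \<xi>)"

text \<open>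
  The quotient \<open>1 / (\<mu>(\<xi>) - 1)\<close> can be formed in the extended reals without a case distinction:
\<close>

lemma one_over_infinity_minus_one: "1 / ((\<infinity>::ereal) - 1) = 0"
  by simp

end

theory Submission
  imports Defs "HOL-Analysis.Kronecker_Approximation_Theorem" "HOL-Real_Asymp.Real_Asymp"
begin

text \<open>
  Applying the definition of \<open>T3_set\<close> with \<open>\<epsilon>\<^sub>n = Q\<^sub>n powr -\<tau>\<close> shows that this set is contained in the
  other three. Conversely, membership of \<open>\<tau>\<close> in any of the sets yields small linear forms
  \<open>u\<^sub>n \<xi> - v\<^sub>n\<close> whose logarithms grow without gaps. Given \<open>p/q\<close>, the first form of size at most
  \<open>1/(2q)\<close> has either \<open>u\<^sub>n p \<noteq> v\<^sub>n q\<close>, so that \<open>\<bar>u\<^sub>n\<bar> \<bar>q \<xi> - p\<bar> \<ge> 1/2\<close>, or \<open>p/q = v\<^sub>n/u\<^sub>n\<close>; both cases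
  bound \<open>\<bar>\<xi> - p/q\<bar>\<close> from below and give \<open>\<mu>(\<xi>) \<le> 1 + 1/\<tau>\<close>.

  It remains to put every \<open>\<tau> < 1/(\<mu>(\<xi>) - 1)\<close> into \<open>T3_set\<close>. For an admissible exponent \<open>m\<close> close to
  \<open>\<mu>(\<xi>)\<close> and every \<open>N\<close>, two applications of Dirichlet's theorem give independent integer vectors
  \<open>(q, p)\<close> with \<open>\<bar>q\<bar> = O(N powr (m - 1))\<close> and \<open>\<bar>q \<xi> - p\<bar> \<le> 1/N\<close>. Rounding the coordinates of the
  target \<open>(Q\<^sub>n, \<epsilon>\<^sub>n)\<close> with respect to them, where \<open>N\<close> is about \<open>Q\<^sub>n powr \<sigma>\<close> with
  \<open>\<tau> < \<sigma> < 1/(m - 1)\<close>, produces errors \<open>o(Q\<^sub>n)\<close> and \<open>o(\<epsilon>\<^sub>n)\<close>.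
\<close>

subsection \<open>Independent small linear forms\<close>

definition exponents :: "real \<Rightarrow> real set" where
  "exponents \<xi> = {m. \<exists>q0::int. \<forall>p q::int. q \<ge> q0 \<longrightarrow>
     \<bar>\<xi> - real_of_int p / real_of_int q\<bar> > real_of_int q powr (- m)}"

lemma irrationality_exponent_eq_Inf: "irrationality_exponent \<xi> = Inf (ereal ` exponents \<xi>)"
  by (simp add: irrationality_exponent_def exponents_def)

lemma int_linear_form_nonzero:
  fixes u v :: int
  assumes "\<xi> \<notin> \<rat>" "u \<noteq> 0"
  shows "of_int u * \<xi> - of_int v \<noteq> 0"
proof
  assume "of_int u * \<xi> - of_int v = 0"
  then have "\<xi> = of_int v / of_int u" using assms by (simp add: field_simps)
  then show False using assms(1) by simp
qed

lemma dist_ints_pos: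
  fixes x :: real
  assumes "x \<notin> \<int>"
  shows "\<exists>d>0. \<forall>p::int. d \<le> \<bar>x - of_int p\<bar>"
proof (intro exI conjI allI)
  have "frac x \<noteq> 0" using assms by (simp add: frac_eq_0_iff)
  then show "0 < min (frac x) (1 - frac x)"
    using frac_ge_0[of x] frac_lt_1[of x] by simp
  fix p :: int
  show "min (frac x) (1 - frac x) \<le> \<bar>x - of_int p\<bar>"
  proof (cases "p \<le> \<lfloor>x\<rfloor>")
    case True
    then have "real_of_int p \<le> of_int \<lfloor>x\<rfloor>" by simp
    then show ?thesis by (simp add: frac_def)
  next
    case False
    then have "real_of_int p \<ge> of_int \<lfloor>x\<rfloor> + 1" by linarith
    then show ?thesis by (simp add: frac_def)
  qed
qed

text \<open>An exponent controls only denominators beyond some \<open>q0\<close>. Below that,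
  irrationality keeps \<open>q * \<xi>\<close> at positive distance from the integers, so the
  finitely many remaining denominators can be absorbed into the constant \<open>c\<close>.\<close>

lemma exponents_lower_bound:
  assumes "\<xi> \<notin> \<rat>" "m \<in> exponents \<xi>"
  obtains c where "c > 0"
    "\<And>p q::int. q \<ge> 1 \<Longrightarrow> c * of_int q powr (1 - m) \<le> \<bar>of_int q * \<xi> - of_int p\<bar>"
proof -
  obtain q0 :: int where q0:
    "\<And>p q::int. q \<ge> q0 \<Longrightarrow> \<bar>\<xi> - of_int p / of_int q\<bar> > of_int q powr (- m)"
    using assms(2) by (auto simp: exponents_def)
  have "\<exists>d>0. \<forall>p::int. d \<le> \<bar>of_int q * \<xi> - of_int p\<bar>" if "q \<ge> 1" for q :: int
    using int_linear_form_nonzero[OF assms(1), of q] that by (intro dist_ints_pos) (auto elim!: Ints_cases)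
  then obtain d where d: "\<And>q. q \<ge> 1 \<Longrightarrow> d q > 0"
    "\<And>p q::int. q \<ge> 1 \<Longrightarrow> d q \<le> \<bar>of_int q * \<xi> - of_int p\<bar>"
    by metis
  \<comment> \<open>The entry 1 handles denominators above \<open>q0\<close>, where the bound holds
    with constant 1, and keeps the set nonempty when \<open>q0 < 1\<close>.\<close>
  define c where "c = Min (insert 1 ((\<lambda>q::int. d q / of_int q powr (1 - m)) ` {1..q0}))"
  show thesis
  proof
    show "c > 0" unfolding c_def by (subst Min_gr_iff) (auto simp: d)
    fix p q :: int
    assume q: "q \<ge> 1"
    show "c * of_int q powr (1 - m) \<le> \<bar>of_int q * \<xi> - of_int p\<bar>"
    proof (cases "q \<le> q0")
      case True
      then have "c \<le> d q / of_int q powr (1 - m)" unfolding c_def using q by (intro Min_le) auto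
      then have "c * of_int q powr (1 - m) \<le> d q" using q by (simp add: field_simps)
      then show ?thesis using d(2)[OF q, of p] by linarith
    next
      case False
      have "c \<le> 1" unfolding c_def by (intro Min_le) auto
      then have "c * of_int q powr (1 - m) \<le> of_int q powr (1 - m)"
        using mult_right_mono[of c 1 "of_int q powr (1 - m)"] by simp
      also have "\<dots> = of_int q * of_int q powr (- m)"
        using q by (simp add: powr_diff powr_minus field_simps)
      also have "\<dots> \<le> of_int q * \<bar>\<xi> - of_int p / of_int q\<bar>"
        using q0[of q p] False q by (intro mult_left_mono) auto
      also have "\<dots> = \<bar>of_int q * (\<xi> - of_int p / of_int q)\<bar>"
        using q by (simp add: abs_mult)
      also have "\<dots> = \<bar>of_int q * \<xi> - of_int p\<bar>"
        using q by (simp add: algebra_simps)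
      finally show ?thesis .
    qed
  qed
qed

text \<open>Dirichlet's theorem supplies, for every \<open>N\<close>, a form below
  \<open>1 / N\<close> with denominator at most \<open>N\<close>. An exponent below 2 would bound
  the same form from below by a multiple of \<open>N powr (- k)\<close> with \<open>k < 1\<close>,
  which fails for large \<open>N\<close>.\<close>

lemma exponents_ge_2:
  assumes "\<xi> \<notin> \<rat>" "m \<in> exponents \<xi>"
  shows "m \<ge> 2"
proof (rule ccontr)
  assume m: "\<not> m \<ge> 2"
  obtain c where c: "c > 0"
    "\<And>p q::int. q \<ge> 1 \<Longrightarrow> c * of_int q powr (1 - m) \<le> \<bar>of_int q * \<xi> - of_int p\<bar>"
    using exponents_lower_bound[OF assms] by blast
  \<comment> \<open>Truncation at 0 makes \<open>q powr (- k)\<close> nonincreasing in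
    \<open>q\<close> even when \<open>m < 1\<close>, so that \<open>q \<le> N\<close> can be
    used.\<close>
  define k where "k = max (m - 1) 0"
  have k: "k < 1" "0 \<le> k" using m by (auto simp: k_def)
  have bound: "c * real N powr (1 - k) \<le> 1" if N: "N > 0" for N :: nat
  proof -
    obtain p q :: int where pq: "0 < q" "q \<le> int N" "\<bar>of_int q * \<xi> - of_int p\<bar> < 1 / N"
      using Dirichlet_approx[OF N] by metis
    have "of_int q \<le> real N" using pq(2) by linarith
    then have "real N powr (- k) \<le> of_int q powr (- k)"
      using pq(1) k(2) by (intro powr_mono2') auto
    also have "\<dots> \<le> of_int q powr (1 - m)"
      using pq(1) by (intro powr_mono) (auto simp: k_def)
    finally have "c * real N powr (- k) \<le> c * of_int q powr (1 - m)" using c(1) by simp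
    also have "\<dots> \<le> 1 / N" using c(2)[of q p] pq by linarith
    finally show ?thesis using N by (simp add: powr_diff powr_minus field_simps)
  qed
  have "filterlim (\<lambda>N::nat. c * real N powr (1 - k)) at_top sequentially"
    using c(1) k(1)
    by real_asymp
  then have "eventually (\<lambda>N::nat. c * real N powr (1 - k) > 1 \<and> N > 0) sequentially"
    by (intro eventually_conj eventually_gt_at_top) (simp add: filterlim_at_top_dense)
  then obtain N :: nat where "c * real N powr (1 - k) > 1" "N > 0"
    by (auto simp: eventually_sequentially)
  with bound[of N] show False by linarith
qed

text \<open>
  The second vector comes from Dirichlet's theorem with bound \<open>1/\<delta>\<close>, where \<open>\<delta> = \<bar>q \<xi> - p\<bar>\<close>:
  a form smaller than \<open>\<delta>\<close> cannot come from a multiple of the primitive vector \<open>(q, p)\<close>.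
\<close>

lemma two_independent_forms:
  fixes N :: nat
  assumes lb: "\<And>p q::int. q \<ge> 1 \<Longrightarrow> c * of_int q powr (1 - m) \<le> \<bar>of_int q * \<xi> - of_int p\<bar>"
    and c: "c > 0" and m: "m \<ge> 2" and N: "N > 0"
  obtains p q p' q' :: int where "q * p' \<noteq> q' * p"
    "\<bar>of_int q\<bar> \<le> (1 / c + 1) * real N powr (m - 1)" "\<bar>of_int q * \<xi> - of_int p\<bar> \<le> 1 / N"
    "\<bar>of_int q'\<bar> \<le> (1 / c + 1) * real N powr (m - 1)" "\<bar>of_int q' * \<xi> - of_int p'\<bar> \<le> 1 / N"
proof -
  obtain p q :: int where pq: "coprime p q" "0 < q" "q \<le> int N" "\<bar>of_int q * \<xi> - of_int p\<bar> < 1 / N"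
    using Dirichlet_approx_coprime[OF N] by metis
  define \<delta> where "\<delta> = \<bar>of_int q * \<xi> - of_int p\<bar>"
  have qN: "of_int q \<le> real N" using pq(3) by linarith
  have N1: "real N \<ge> 1" using N by simp
  have "c * real N powr (1 - m) \<le> c * of_int q powr (1 - m)"
    using pq(2) qN m c by (intro mult_left_mono powr_mono2') auto
  also have "\<dots> \<le> \<delta>" using lb[of q p] pq(2) by (simp add: \<delta>_def)
  finally have \<delta>: "c * real N powr (1 - m) \<le> \<delta>" .
  have "0 < c * real N powr (1 - m)" using c N by simp
  with \<delta> have \<delta>0: "\<delta> > 0" by linarith
  have "1 / \<delta> \<le> 1 / (c * real N powr (1 - m))"
    using \<delta> \<open>0 < c * _\<close> by (intro divide_left_mono) auto
  also have "\<dots> = 1 / c * real N powr (m - 1)"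
    by (simp add: powr_diff)
  finally have inv: "1 / \<delta> \<le> 1 / c * real N powr (m - 1)" .
  \<comment> \<open>Here \<open>m \<ge> 2\<close> enters: the first denominator, at most
    \<open>N\<close>, and the 1 lost by rounding \<open>1 / \<delta>\<close> up both fit under
    \<open>N powr (m - 1)\<close>. This accounts for the summand 1 in
    \<open>1 / c + 1\<close>.\<close>
  have big: "real N \<le> real N powr (m - 1)"
    using powr_mono[of 1 "m - 1" "real N"] m N1 by simp
  define N' where "N' = nat \<lceil>1 / \<delta>\<rceil>"
  have N': "real N' \<ge> 1 / \<delta>" "real N' \<le> 1 / \<delta> + 1"
    using \<delta>0 by (auto simp: N'_def; linarith)+
  have "N' > 0" using N'(1) \<delta>0 by (cases N') auto
  then obtain p' q' :: int where pq': "0 < q'" "q' \<le> int N'" "\<bar>of_int q' * \<xi> - of_int p'\<bar> < 1 / N'"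
    using Dirichlet_approx by metis
  have "1 / N' \<le> \<delta>" using N'(1) \<delta>0 \<open>N' > 0\<close> by (simp add: field_simps)
  then have small: "\<bar>of_int q' * \<xi> - of_int p'\<bar> < \<delta>" using pq' by linarith
  show thesis
  proof
    show "q * p' \<noteq> q' * p"
    proof
      assume eq: "q * p' = q' * p"
      then have "q dvd q' * p" by (metis dvd_triv_left)
      then have "q dvd q'" using pq(1) by (simp add: coprime_commute coprime_dvd_mult_left_iff)
      then obtain k where k: "q' = q * k" by blast
      then have "p' = p * k" using eq pq(2) by auto
      then have "\<bar>of_int q' * \<xi> - of_int p'\<bar> = \<bar>real_of_int k\<bar> * \<delta>"
        by (simp add: k \<delta>_def abs_mult[symmetric] algebra_simps)
      moreover have "\<bar>real_of_int k\<bar> \<ge> 1" using k pq'(1) by (cases "k = 0") auto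
      ultimately show False using small \<delta>0 mult_right_mono[of 1 "\<bar>real_of_int k\<bar>" \<delta>] by simp
    qed
    show "\<bar>of_int q\<bar> \<le> (1 / c + 1) * real N powr (m - 1)"
    proof -
      have "0 \<le> 1 / c * real N powr (m - 1)" using c by simp
      then show ?thesis using qN big pq(2) by (simp add: algebra_simps)
    qed
    show "\<bar>of_int q * \<xi> - of_int p\<bar> \<le> 1 / N" using pq by simp
    show "\<bar>of_int q' * \<xi> - of_int p'\<bar> \<le> 1 / N" using small pq by (simp add: \<delta>_def)
    have "of_int q' \<le> real N'" using pq'(2) by linarith
    also have "\<dots> \<le> 1 / c * real N powr (m - 1) + real N powr (m - 1)"
      using N'(2) inv big N1 by linarith
    finally show "\<bar>of_int q'\<bar> \<le> (1 / c + 1) * real N powr (m - 1)"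
      using pq'(1) by (simp add: algebra_simps)
  qed
qed

text \<open>In the coordinates (\<open>u\<close>, \<open>u * \<xi> - v\<close>) the two integer
  vectors form a basis of the plane. Cramer's rule writes the target (\<open>x\<close>,
  \<open>y\<close>) as a real combination of them, and taking the floor of both coefficients moves
  each coordinate by fractional parts times the basis entries.\<close>

lemma round_to_lattice:
  fixes p q p' q' :: int and x y \<xi> :: real
  assumes "q * p' \<noteq> q' * p"
  obtains u v :: int where "\<bar>of_int u - x\<bar> \<le> \<bar>of_int q\<bar> + \<bar>of_int q'\<bar>"
    "\<bar>of_int u * \<xi> - of_int v - y\<bar> \<le> \<bar>of_int q * \<xi> - of_int p\<bar> + \<bar>of_int q' * \<xi> - of_int p'\<bar>"
proof -
  define r where "r = of_int q * \<xi> - of_int p"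
  define r' where "r' = of_int q' * \<xi> - of_int p'"
  \<comment> \<open>This is the determinant of the basis. The multiples of \<xi> cancel, so it is
    the integer \<open>q' * p - q * p'\<close>, nonzero by assumption.\<close>
  define D where "D = of_int q * r' - of_int q' * r"
  have "D = of_int (q' * p - q * p')" by (simp add: D_def r_def r'_def algebra_simps)
  then have D: "D \<noteq> 0" using assms by (simp del: of_int_diff of_int_mult)
  define a where "a = (x * r' - y * of_int q') / D"
  define b where "b = (y * of_int q - x * r) / D"
  have "a * of_int q + b * of_int q' = ((x * r' - y * of_int q') * of_int q + (y * of_int q - x * r) * of_int q') / D"
    by (simp add: a_def b_def add_divide_distrib)
  also have "\<dots> = x * D / D" by (simp add: D_def algebra_simps)
  finally have x: "x = a * of_int q + b * of_int q'" using D by simp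
  have "a * r + b * r' = ((x * r' - y * of_int q') * r + (y * of_int q - x * r) * r') / D"
    by (simp add: a_def b_def add_divide_distrib)
  also have "\<dots> = y * D / D" by (simp add: D_def algebra_simps)
  finally have y: "y = a * r + b * r'" using D by simp
  have le: "\<bar>of_int \<lfloor>a\<rfloor> * s + of_int \<lfloor>b\<rfloor> * t - (a * s + b * t)\<bar> \<le> \<bar>s\<bar> + \<bar>t\<bar>" for s t :: real
  proof -
    have "\<bar>of_int \<lfloor>a\<rfloor> * s + of_int \<lfloor>b\<rfloor> * t - (a * s + b * t)\<bar> = \<bar>frac a * s + frac b * t\<bar>"
      by (simp add: frac_def algebra_simps abs_minus_commute)
    also have "\<dots> \<le> \<bar>frac a * s\<bar> + \<bar>frac b * t\<bar>" by (rule abs_triangle_ineq)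
    also have "\<dots> \<le> \<bar>s\<bar> + \<bar>t\<bar>"
      by (intro add_mono) (auto simp: abs_mult intro!: mult_left_le_one_le less_imp_le[OF frac_lt_1])
    finally show ?thesis .
  qed
  show thesis
  proof
    show "\<bar>of_int (\<lfloor>a\<rfloor> * q + \<lfloor>b\<rfloor> * q') - x\<bar> \<le> \<bar>of_int q\<bar> + \<bar>of_int q'\<bar>"
      using le[of "of_int q" "of_int q'"] x by simp
    have "of_int (\<lfloor>a\<rfloor> * q + \<lfloor>b\<rfloor> * q') * \<xi> - of_int (\<lfloor>a\<rfloor> * p + \<lfloor>b\<rfloor> * p')
      = of_int \<lfloor>a\<rfloor> * r + of_int \<lfloor>b\<rfloor> * r'"
      by (simp add: r_def r'_def algebra_simps)
    then show "\<bar>of_int (\<lfloor>a\<rfloor> * q + \<lfloor>b\<rfloor> * q') * \<xi> - of_int (\<lfloor>a\<rfloor> * p + \<lfloor>b\<rfloor> * p') - y\<bar>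
      \<le> \<bar>of_int q * \<xi> - of_int p\<bar> + \<bar>of_int q' * \<xi> - of_int p'\<bar>"
      using le[of r r'] y by (simp add: r_def r'_def)
  qed
qed

subsection \<open>Dense linear forms bound the irrationality exponent\<close>

text \<open>
  The property common to all four sets, in logarithmic form. Since \<open>ln 0 = 0\<close>, the divergence
  of \<open>L\<close> forces the forms, and hence \<open>u n\<close>, to be nonzero eventually.
\<close>

definition dense_forms :: "real \<Rightarrow> real \<Rightarrow> bool" where
  "dense_forms \<xi> \<tau> \<longleftrightarrow> (\<exists>(u :: nat \<Rightarrow> int) (v :: nat \<Rightarrow> int) L.
     L = (\<lambda>n. - ln \<bar>of_int (u n) * \<xi> - of_int (v n)\<bar>) \<and>
     filterlim L at_top sequentially \<and> (\<lambda>n. L (Suc n) / L n) \<longlonglongrightarrow> 1 \<and>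
     (\<forall>\<eta>>0. \<forall>\<^sub>F n in sequentially. ln \<bar>of_int (u n)\<bar> \<le> (1 / \<tau> + \<eta>) * L n))"

text \<open>Because \<open>ln 0 = 0\<close>, a positive value of \<open>- ln\<close> excludes a
  vanishing form. With \<open>u = 0\<close> the form would be an integer of absolute value below 1,
  hence zero.\<close>

lemma form_lt_1:
  fixes u v :: int and \<xi> :: real
  assumes "- ln \<bar>of_int u * \<xi> - of_int v\<bar> > 0"
  shows "\<bar>of_int u * \<xi> - of_int v\<bar> > 0" "\<bar>of_int u * \<xi> - of_int v\<bar> < 1" "u \<noteq> 0"
proof -
  show pos: "\<bar>of_int u * \<xi> - of_int v\<bar> > 0"
    using assms by (cases "of_int u * \<xi> - of_int v = 0") auto
  then show lt: "\<bar>of_int u * \<xi> - of_int v\<bar> < 1"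
    using assms by (simp add: ln_less_zero_iff)
  show "u \<noteq> 0"
  proof
    assume "u = 0"
    with lt have "\<bar>real_of_int v\<bar> < 1" by simp
    then have "v = 0" by linarith
    with pos \<open>u = 0\<close> show False by simp
  qed
qed

text \<open>For a denominator \<open>q\<close>, a form of size about \<open>1 / (2 * q)\<close> is
  selected. Missing the exact size costs a factor \<open>1 + \<eta>\<close> in the logarithm, the
  bound on \<open>u n\<close> a summand \<eta>. The resulting exponent \<open>K\<close> tends to
  \<open>1 + 1 / \<tau>\<close> as \<eta> tends to 0, so it can be kept below
  \<open>m\<close>.\<close>

lemma dense_forms_exponents:
  assumes dense: "dense_forms \<xi> \<tau>" and "\<tau> > 0" and m: "m > 1 + 1 / \<tau>"
  shows "m \<in> exponents \<xi>"
proof -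
  obtain u v :: "nat \<Rightarrow> int" and L where
    L: "L = (\<lambda>n. - ln \<bar>of_int (u n) * \<xi> - of_int (v n)\<bar>)" and
    Linf: "filterlim L at_top sequentially" and ratio: "(\<lambda>n. L (Suc n) / L n) \<longlonglongrightarrow> 1" and
    bnd: "\<And>\<eta>. \<eta> > 0 \<Longrightarrow> \<forall>\<^sub>F n in sequentially. ln \<bar>of_int (u n)\<bar> \<le> (1 / \<tau> + \<eta>) * L n"
    using dense unfolding dense_forms_def by blast
  define \<sigma> where "\<sigma> = 1 / \<tau>"
  have \<sigma>: "\<sigma> > 0" using assms by (simp add: \<sigma>_def)
  have "((\<lambda>\<eta>::real. (1 + \<eta>) * (1 + \<sigma> + \<eta>)) \<longlongrightarrow> (1 + 0) * (1 + \<sigma> + 0)) (at_right 0)"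
    by (intro tendsto_intros)
  then have "\<forall>\<^sub>F \<eta> in at_right 0. (1 + \<eta>) * (1 + \<sigma> + \<eta>) < m"
    using m by (intro order_tendstoD(2)) (auto simp: \<sigma>_def)
  with eventually_at_right_less[of "0::real"]
  have "\<forall>\<^sub>F \<eta> in at_right 0. (1 + \<eta>) * (1 + \<sigma> + \<eta>) < m \<and> 0 < \<eta>"
    by eventually_elim auto
  then obtain \<eta> :: real where \<eta>: "\<eta> > 0" "(1 + \<eta>) * (1 + \<sigma> + \<eta>) < m"
    using eventually_happens'[OF trivial_limit_at_right_real[of 0]] by blast
  define K where "K = (1 + \<eta>) * (1 + \<sigma> + \<eta>)"
  have "\<forall>\<^sub>F n in sequentially. L n > 0" using Linf by (simp add: filterlim_at_top_dense)
  moreover have "\<forall>\<^sub>F n in sequentially. L (Suc n) / L n < 1 + \<eta>"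
    using ratio \<eta>(1) by (intro order_tendstoD(2)) auto
  ultimately have "\<forall>\<^sub>F n in sequentially. L n > 0 \<and> L (Suc n) \<le> (1 + \<eta>) * L n
      \<and> ln \<bar>of_int (u n)\<bar> \<le> (\<sigma> + \<eta>) * L n"
    using bnd[OF \<eta>(1)] by eventually_elim (auto simp: field_simps \<sigma>_def)
  then obtain N where N: "\<And>n. n \<ge> N \<Longrightarrow> L n > 0" "\<And>n. n \<ge> N \<Longrightarrow> L (Suc n) \<le> (1 + \<eta>) * L n"
    "\<And>n. n \<ge> N \<Longrightarrow> ln \<bar>of_int (u n)\<bar> \<le> (\<sigma> + \<eta>) * L n"
    by (auto simp: eventually_sequentially)
  \<comment> \<open>The first index with \<open>L n \<ge> \<Lambda>\<close> works: its predecessor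
    lies below \<Lambda>, so the ratio bound limits the overshoot. The condition
    \<open>\<Lambda> > L N\<close> ensures that this predecessor is still at least
    \<open>N\<close>.\<close>
  have select: "\<exists>n\<ge>N. \<Lambda> \<le> L n \<and> L n \<le> (1 + \<eta>) * \<Lambda> \<and> ln \<bar>of_int (u n)\<bar> \<le> (\<sigma> + \<eta>) * (1 + \<eta>) * \<Lambda>"
    if \<Lambda>: "\<Lambda> > L N" for \<Lambda>
  proof -
    have "\<forall>\<^sub>F n in sequentially. n \<ge> N \<and> \<Lambda> \<le> L n"
      using Linf by (intro eventually_conj eventually_ge_at_top) (simp add: filterlim_at_top)
    then have ex: "\<exists>n. n \<ge> N \<and> \<Lambda> \<le> L n" by (auto simp: eventually_sequentially)
    define n where "n = (LEAST n. n \<ge> N \<and> \<Lambda> \<le> L n)"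
    have n: "n \<ge> N" "\<Lambda> \<le> L n" using LeastI_ex[OF ex] by (auto simp: n_def)
    then have "n \<noteq> N" using \<Lambda> by auto
    then obtain k where k: "n = Suc k" "k \<ge> N" using n(1) by (cases n) auto
    have "L k < \<Lambda>" using not_less_Least[of k "\<lambda>n. n \<ge> N \<and> \<Lambda> \<le> L n"] k by (auto simp: n_def)
    then have "(1 + \<eta>) * L k \<le> (1 + \<eta>) * \<Lambda>" using \<eta>(1) by simp
    with N(2)[OF k(2)] have Ln: "L n \<le> (1 + \<eta>) * \<Lambda>" by (simp add: k(1))
    have "ln \<bar>of_int (u n)\<bar> \<le> (\<sigma> + \<eta>) * ((1 + \<eta>) * \<Lambda>)"
      using N(3)[OF n(1)] mult_left_mono[OF Ln, of "\<sigma> + \<eta>"] \<sigma> \<eta>(1) by linarith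
    with n Ln show ?thesis by (auto simp: mult.assoc)
  qed
  have main: "(2 * of_int q) powr (- K) \<le> \<bar>\<xi> - of_int p / of_int q\<bar>"
    if q: "q \<ge> 1" "ln (2 * of_int q) > L N" for p q :: int
  proof -
    define \<Lambda> where "\<Lambda> = ln (2 * real_of_int q)"
    have \<Lambda>0: "\<Lambda> > 0" using q N(1)[of N] by (simp add: \<Lambda>_def)
    obtain n where n: "n \<ge> N" "\<Lambda> \<le> L n" "L n \<le> (1 + \<eta>) * \<Lambda>"
      "ln \<bar>of_int (u n)\<bar> \<le> (\<sigma> + \<eta>) * (1 + \<eta>) * \<Lambda>"
      using select q(2) unfolding \<Lambda>_def by blast
    define x where "x = \<bar>of_int (u n) * \<xi> - of_int (v n)\<bar>"
    have Ln: "L n = - ln x" by (simp add: L x_def)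
    have x: "0 < x" "u n \<noteq> 0"
      using form_lt_1[of "u n" \<xi> "v n"] N(1)[OF n(1)] by (auto simp: L x_def)
    define U where "U = \<bar>real_of_int (u n)\<bar>"
    have U: "U > 0" using x by (simp add: U_def)
    have "x = exp (- L n)" using x by (simp add: Ln)
    also have "\<dots> \<le> exp (- \<Lambda>)" using n by simp
    also have "\<dots> = 1 / (2 * of_int q)" using q by (simp add: \<Lambda>_def exp_minus field_simps)
    finally have x_le: "x \<le> 1 / (2 * of_int q)" .
    have KL: "K * \<Lambda> = (1 + \<eta>) * \<Lambda> + (\<sigma> + \<eta>) * (1 + \<eta>) * \<Lambda>"
      by (simp add: K_def algebra_simps)
    have pw: "(2 * of_int q) powr (- K) = exp (- (K * \<Lambda>))"
      using q by (simp add: powr_def \<Lambda>_def)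
    show ?thesis
    proof (cases "u n * p = v n * q")
      \<comment> \<open>Here \<open>p / q\<close> equals \<open>v n / u n\<close>, so the distance
        is exactly \<open>x / U\<close>, and the upper bounds on \<open>L n\<close> and
        \<open>ln U\<close> suffice.\<close>
      case True
      then have "real_of_int (u n) * of_int p = of_int (v n) * of_int q"
        by (metis of_int_mult)
      then have "\<xi> - of_int p / of_int q = (of_int (u n) * \<xi> - of_int (v n)) / of_int (u n)"
        using x q by (simp add: field_simps)
      then have "\<bar>\<xi> - of_int p / of_int q\<bar> = x / U"
        by (simp add: x_def U_def abs_divide)
      also have "\<dots> = exp (- (L n + ln U))"
        using x U by (simp add: Ln exp_diff)
      finally show ?thesis
        using n KL by (simp add: pw U_def)
    next
      \<comment> \<open>The integer \<open>u n * p - v n * q\<close> has absolute value at least 1.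
        The choice of scale makes \<open>q * x\<close> at most 1/2, which leaves at least 1/2 for
        the term containing \<open>q * \<xi> - p\<close>.\<close>
      case False
      then have "1 \<le> \<bar>real_of_int (u n * p - v n * q)\<bar>"
        unfolding of_int_abs[symmetric] by (simp only: of_int_1_le_iff)
      also have "real_of_int (u n * p - v n * q)
          = of_int q * (of_int (u n) * \<xi> - of_int (v n)) - of_int (u n) * (of_int q * \<xi> - of_int p)"
        by (simp add: algebra_simps)
      also have "\<bar>\<dots>\<bar> \<le> of_int q * x + U * \<bar>of_int q * \<xi> - of_int p\<bar>"
        using q by (intro order_trans[OF abs_triangle_ineq4]) (simp add: abs_mult x_def U_def)
      also have "of_int q * x \<le> 1 / 2" using x_le q by (simp add: field_simps)
      finally have "1 / 2 \<le> U * \<bar>of_int q * \<xi> - of_int p\<bar>" by simp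
      moreover have "\<bar>of_int q * \<xi> - of_int p\<bar> = of_int q * \<bar>\<xi> - of_int p / of_int q\<bar>"
      proof -
        have "of_int q * \<xi> - of_int p = of_int q * (\<xi> - of_int p / of_int q)"
          using q by (simp add: field_simps)
        then show ?thesis using q by (simp add: abs_mult)
      qed
      ultimately have "1 / (2 * of_int q) / U \<le> \<bar>\<xi> - of_int p / of_int q\<bar>"
        using q U by (simp add: field_simps)
      moreover have "1 / (2 * of_int q) / U = exp (- (\<Lambda> + ln U))"
        using q U by (simp add: \<Lambda>_def exp_minus exp_diff field_simps)
      moreover have "\<Lambda> + ln U \<le> K * \<Lambda>"
        using n KL \<eta>(1) \<Lambda>0 mult_right_mono[of 1 "1 + \<eta>" \<Lambda>] by (simp add: U_def)
      ultimately show ?thesis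
        using pw by (smt (verit) exp_le_cancel_iff)
    qed
  qed
  \<comment> \<open>The first entry brings \<open>ln (2 * q)\<close> above \<open>L N\<close>, so
    \<open>main\<close> applies; the second lets the gap \<open>m - K\<close> absorb the factor 2 in
    \<open>2 * q\<close>.\<close>
  define B where "B = max (exp (L N)) (exp (K * ln 2 / (m - K)))"
  have "\<bar>\<xi> - of_int p / of_int q\<bar> > of_int q powr (- m)"
    if q: "q \<ge> \<lceil>B\<rceil> + 1" for p q :: int
  proof -
    have qB: "of_int q > B" using q by linarith
    then have "of_int q > exp (L N)" by (simp add: B_def)
    then have "real_of_int q > 0" using exp_gt_zero less_trans by blast
    then have q1: "q \<ge> 1" by simp
    have "ln (of_int q) > L N"
      using qB q1 exp_less_cancel_iff[of "L N" "ln (of_int q)"] by (simp add: B_def)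
    moreover have "ln (2 * real_of_int q) = ln 2 + ln (of_int q)" using q1 by (simp add: ln_mult)
    moreover have "ln (2::real) > 0" by simp
    ultimately have 1: "ln (2 * of_int q) > L N" by linarith
    have "ln (of_int q) > K * ln 2 / (m - K)"
      using qB q1 exp_less_cancel_iff[of "K * ln 2 / (m - K)" "ln (of_int q)"] by (simp add: B_def)
    then have "K * ln 2 < ln (of_int q) * (m - K)"
      using \<eta>(2) by (simp add: K_def pos_divide_less_eq)
    then have "- m * ln (of_int q) < - K * ln (2 * of_int q)"
      using q1 by (simp add: ln_mult algebra_simps)
    then have "of_int q powr (- m) < (2 * of_int q) powr (- K)"
      using q1 by (simp add: powr_def)
    with main[OF q1 1, of p] show ?thesis by linarith
  qed
  then show ?thesis unfolding exponents_def by blast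
qed

section \<open>From \<open>T0_set\<close>, \<open>T1_set\<close> and \<open>T2_set\<close> to dense
  forms\<close>

lemma asymptotic_ratio:
  fixes s L :: "nat \<Rightarrow> real"
  assumes Ls: "(\<lambda>n. L n / s n) \<longlonglongrightarrow> c" "c > 0" and s: "filterlim s at_top sequentially"
    "(\<lambda>n. s (Suc n) / s n) \<longlonglongrightarrow> 1"
  shows "filterlim L at_top sequentially" "(\<lambda>n. L (Suc n) / L n) \<longlonglongrightarrow> 1"
proof -
  have spos: "\<forall>\<^sub>F n in sequentially. s n > 0" using s(1) by (simp add: filterlim_at_top_dense)
  have "filterlim (\<lambda>n. L n / s n * s n) at_top sequentially"
    by (rule filterlim_tendsto_pos_mult_at_top[OF Ls s(1)])
  then show Linf: "filterlim L at_top sequentially"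
    by (rule filterlim_cong[THEN iffD1, rotated -1]) (auto intro!: eventually_mono[OF spos])
  have Lpos: "\<forall>\<^sub>F n in sequentially. L n > 0" using Linf by (simp add: filterlim_at_top_dense)
  \<comment> \<open>The ratio is factored through the scale \<open>s\<close>; the limits
    \<open>c\<close> of \<open>L / s\<close> at consecutive indices then cancel.\<close>
  have ev: "\<forall>\<^sub>F n in sequentially.
      L (Suc n) / s (Suc n) * (s (Suc n) / s n) / (L n / s n) = L (Suc n) / L n"
    using spos Lpos eventually_sequentially_Suc[THEN iffD2, OF spos]
    by eventually_elim (simp add: field_simps)
  have "(\<lambda>n. L (Suc n) / s (Suc n) * (s (Suc n) / s n) / (L n / s n)) \<longlonglongrightarrow> c * 1 / c"
    using Ls by (intro tendsto_intros s(2) LIMSEQ_Suc[OF Ls(1)]) auto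
  from Lim_transform_eventually[OF this ev] Ls(2)
  show "(\<lambda>n. L (Suc n) / L n) \<longlonglongrightarrow> 1" by simp
qed

text \<open>Logarithms turn the first power relation into
  \<open>L (Suc n) = (1 + \<delta> n) * L n\<close> and the second into
  \<open>(\<tau> - \<delta>' n) * ln \<bar>u n\<bar> \<le> L n\<close>. Irrationality and
  \<open>u n \<noteq> 0\<close> make all logarithms genuine.\<close>

lemma dense_forms_T0:
  assumes irr: "\<xi> \<notin> \<rat>" and T: "\<tau> \<in> T0_set \<xi>"
  shows "dense_forms \<xi> \<tau>"
proof -
  obtain u v :: "nat \<Rightarrow> int" and \<delta> \<delta>' :: "nat \<Rightarrow> real" where \<tau>: "\<tau> > 0" and u: "\<And>n. u n \<noteq> 0" and
    lim: "(\<lambda>n. of_int (u n) * \<xi> - of_int (v n)) \<longlonglongrightarrow> 0" and \<delta>: "\<delta> \<longlonglongrightarrow> 0" "\<delta>' \<longlonglongrightarrow> 0" and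
    eq: "\<And>n. \<bar>of_int (u (Suc n)) * \<xi> - of_int (v (Suc n))\<bar> = \<bar>of_int (u n) * \<xi> - of_int (v n)\<bar> powr (1 + \<delta> n)" and
    le: "\<And>n. \<bar>of_int (u n) * \<xi> - of_int (v n)\<bar> \<le> \<bar>of_int (u n)\<bar> powr (- \<tau> + \<delta>' n)"
    using T by (auto simp: T0_set_def pow_o1_eq_def pow_o1_le_def)
  define x where "x n = \<bar>of_int (u n) * \<xi> - of_int (v n)\<bar>" for n
  define L where "L n = - ln (x n)" for n
  have x: "x n > 0" for n using int_linear_form_nonzero[OF irr u[of n]] by (simp add: x_def)
  have "x \<longlonglongrightarrow> 0" using tendsto_rabs[OF lim] by (simp add: x_def[abs_def])
  then have "filterlim x (at_right 0) sequentially"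
    by (simp add: filterlim_at x less_imp_neq[OF x, symmetric])
  then have "filterlim (\<lambda>n. ln (x n)) at_bot sequentially"
    by (rule filterlim_compose[OF ln_at_0])
  then have Linf: "filterlim L at_top sequentially"
    by (simp add: L_def[abs_def] filterlim_uminus_at_bot)
  have Lpos: "\<forall>\<^sub>F n in sequentially. L n > 0" using Linf by (simp add: filterlim_at_top_dense)
  have "L (Suc n) = (1 + \<delta> n) * L n" for n
    using eq[of n] x[of n] by (simp add: L_def x_def[symmetric] ln_powr)
  then have "\<forall>\<^sub>F n in sequentially. 1 + \<delta> n = L (Suc n) / L n"
    using Lpos by (auto elim: eventually_mono)
  moreover have "(\<lambda>n. 1 + \<delta> n) \<longlonglongrightarrow> 1 + 0" by (intro tendsto_intros \<delta>)
  ultimately have ratio: "(\<lambda>n. L (Suc n) / L n) \<longlonglongrightarrow> 1"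
    by (auto dest: Lim_transform_eventually)
  have bnd: "\<forall>\<^sub>F n in sequentially. ln \<bar>of_int (u n)\<bar> \<le> (1 / \<tau> + \<eta>) * L n" if "\<eta> > 0" for \<eta>
  proof -
    have "(\<lambda>n. \<tau> - \<delta>' n) \<longlonglongrightarrow> \<tau> - 0" by (intro tendsto_intros \<delta>)
    then have t: "(\<lambda>n. \<tau> - \<delta>' n) \<longlonglongrightarrow> \<tau>" by simp
    have 1: "\<forall>\<^sub>F n in sequentially. \<tau> - \<delta>' n > 0" using t \<tau> by (rule order_tendstoD)
    have "(\<lambda>n. 1 / (\<tau> - \<delta>' n)) \<longlonglongrightarrow> 1 / \<tau>" using \<tau> by (intro tendsto_intros t) auto
    then have 2: "\<forall>\<^sub>F n in sequentially. 1 / (\<tau> - \<delta>' n) < 1 / \<tau> + \<eta>"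
      using \<open>\<eta> > 0\<close> by (intro order_tendstoD(2)) auto
    from 1 2 Lpos show ?thesis
    proof eventually_elim
      case (elim n)
      have "ln (x n) \<le> ln (\<bar>of_int (u n)\<bar> powr (- \<tau> + \<delta>' n))"
        using le[of n] x[of n] by (intro ln_mono) (auto simp: x_def)
      then have "(\<tau> - \<delta>' n) * ln \<bar>of_int (u n)\<bar> \<le> L n"
        using u[of n] by (simp add: L_def ln_powr algebra_simps)
      then have "ln \<bar>of_int (u n)\<bar> \<le> 1 / (\<tau> - \<delta>' n) * L n"
        using elim by (simp add: field_simps)
      also have "\<dots> \<le> (1 / \<tau> + \<eta>) * L n"
        using elim by (intro mult_right_mono) auto
      finally show ?case .
    qed
  qed
  show ?thesis
    unfolding dense_forms_def
    by (rule exI[of _ u], rule exI[of _ v], rule exI[of _ L])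
      (use Linf ratio bnd in \<open>auto simp: L_def x_def\<close>)
qed

text \<open>Common treatment of \<open>T1_set\<close> and \<open>T2_set\<close>, whose sizes are
  measured against a reference scale: \<open>s n = n\<close> with \<open>b = ln \<beta>\<close> for
  the former, \<open>s n = ln (n + 1)\<close> with \<open>b = 1\<close> for the latter. Indices with
  \<open>u n = 0\<close> disappear eventually, once \<open>L n > 0\<close>.\<close>

lemma dense_forms_of_scale:
  fixes u v :: "nat \<Rightarrow> int" and s :: "nat \<Rightarrow> real"
  assumes s: "filterlim s at_top sequentially" "(\<lambda>n. s (Suc n) / s n) \<longlonglongrightarrow> 1"
    and L: "(\<lambda>n. - ln \<bar>of_int (u n) * \<xi> - of_int (v n)\<bar> / s n) \<longlonglongrightarrow> \<tau> * b" and \<tau>: "\<tau> > 0" and b: "b > 0"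
    and u: "\<And>c. c > b \<Longrightarrow> \<forall>\<^sub>F n in sequentially. u n \<noteq> 0 \<longrightarrow> ln \<bar>of_int (u n)\<bar> \<le> c * s n"
  shows "dense_forms \<xi> \<tau>"
proof -
  define L where "L n = - ln \<bar>of_int (u n) * \<xi> - of_int (v n)\<bar>" for n
  have L: "(\<lambda>n. L n / s n) \<longlonglongrightarrow> \<tau> * b" using L by (simp add: L_def)
  have \<tau>b: "\<tau> * b > 0" using \<tau> b by simp
  note Linf = asymptotic_ratio[OF L \<tau>b s]
  have spos: "\<forall>\<^sub>F n in sequentially. s n > 0" using s(1) by (simp add: filterlim_at_top_dense)
  have Lpos: "\<forall>\<^sub>F n in sequentially. L n > 0" using Linf(1) by (simp add: filterlim_at_top_dense)
  have bnd: "\<forall>\<^sub>F n in sequentially. ln \<bar>of_int (u n)\<bar> \<le> (1 / \<tau> + \<eta>) * L n" if \<eta>: "\<eta> > 0" for \<eta>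
  proof -
    have "(\<lambda>n. (1 / \<tau> + \<eta>) * (L n / s n)) \<longlonglongrightarrow> (1 / \<tau> + \<eta>) * (\<tau> * b)"
      by (intro tendsto_intros L)
    \<comment> \<open>The slack \<eta> yields an excess \<open>\<eta> * \<tau> * b\<close> over
      \<open>b\<close>. One half of it enlarges \<open>b\<close> to an admissible \<open>c\<close>;
      the other half covers the convergence of \<open>L n / s n\<close>.\<close>
    moreover have "(1 / \<tau> + \<eta>) * (\<tau> * b) > b + \<eta> * \<tau> * b / 2"
      using \<tau> b \<eta> by (simp add: field_simps)
    ultimately have "\<forall>\<^sub>F n in sequentially. (1 / \<tau> + \<eta>) * (L n / s n) > b + \<eta> * \<tau> * b / 2"
      by (rule order_tendstoD(1))
    moreover have "b + \<eta> * \<tau> * b / 2 > b" using \<tau> b \<eta> by simp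
    then have "\<forall>\<^sub>F n in sequentially. u n \<noteq> 0 \<longrightarrow> ln \<bar>of_int (u n)\<bar> \<le> (b + \<eta> * \<tau> * b / 2) * s n"
      by (rule u)
    ultimately show ?thesis using spos Lpos
    proof eventually_elim
      case (elim n)
      have "u n \<noteq> 0" using form_lt_1(3)[of "u n" \<xi> "v n"] elim by (simp add: L_def)
      with elim have "ln \<bar>of_int (u n)\<bar> \<le> (b + \<eta> * \<tau> * b / 2) * s n" by simp
      also have "\<dots> \<le> (1 / \<tau> + \<eta>) * (L n / s n) * s n"
        using elim by (intro mult_right_mono) auto
      finally show ?case using elim by simp
    qed
  qed
  show ?thesis
    unfolding dense_forms_def
    by (rule exI[of _ u], rule exI[of _ v], rule exI[of _ L]) (use Linf bnd in \<open>auto simp: L_def[abs_def]\<close>)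
qed

lemma dense_forms_T1:
  assumes T: "\<tau> \<in> T1_set \<xi>"
  shows "dense_forms \<xi> \<tau>"
proof -
  obtain u v :: "nat \<Rightarrow> int" and \<alpha> \<beta> :: real where \<tau>: "\<tau> > 0" "0 < \<alpha>" "\<alpha> < 1" "1 < \<beta>"
    and lim: "(\<lambda>n. root n \<bar>of_int (u n) * \<xi> - of_int (v n)\<bar>) \<longlonglongrightarrow> \<alpha>"
    and sup: "limsup (\<lambda>n. ereal (root n \<bar>of_int (u n)\<bar>)) \<le> ereal \<beta>" and eq: "\<tau> = - ln \<alpha> / ln \<beta>"
    using T unfolding T1_set_def by blast
  have lb: "ln \<beta> > 0" using \<tau> by simp
  show ?thesis
  proof (rule dense_forms_of_scale)
    show "filterlim real at_top sequentially" by (rule filterlim_real_sequentially)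
    show "(\<lambda>n. real (Suc n) / real n) \<longlonglongrightarrow> 1" by real_asymp
    show "ln \<beta> > 0" "\<tau> > 0" by fact+
    have "(\<lambda>n. - ln (root n \<bar>of_int (u n) * \<xi> - of_int (v n)\<bar>)) \<longlonglongrightarrow> - ln \<alpha>"
      using \<tau> by (intro tendsto_intros lim) auto
    moreover have "\<forall>\<^sub>F n in sequentially. - ln (root n \<bar>of_int (u n) * \<xi> - of_int (v n)\<bar>)
        = - ln \<bar>of_int (u n) * \<xi> - of_int (v n)\<bar> / n"
      using eventually_gt_at_top[of 0] by eventually_elim (simp add: ln_root)
    ultimately have "(\<lambda>n. - ln \<bar>of_int (u n) * \<xi> - of_int (v n)\<bar> / n) \<longlonglongrightarrow> - ln \<alpha>"
      by (rule Lim_transform_eventually)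
    then show "(\<lambda>n. - ln \<bar>of_int (u n) * \<xi> - of_int (v n)\<bar> / n) \<longlonglongrightarrow> \<tau> * ln \<beta>"
      using lb by (simp add: eq)
    fix c assume "c > ln \<beta>"
    then have "\<beta> < exp c" using \<tau> exp_less_cancel_iff[of "ln \<beta>" c] by simp
    then have "limsup (\<lambda>n. ereal (root n \<bar>of_int (u n)\<bar>)) < ereal (exp c)"
      using sup by (simp add: order_le_less_trans)
    then have "\<forall>\<^sub>F n in sequentially. ereal (root n \<bar>of_int (u n)\<bar>) < ereal (exp c)"
      by (rule Limsup_lessD)
    with eventually_gt_at_top[of 0]
    show "\<forall>\<^sub>F n in sequentially. u n \<noteq> 0 \<longrightarrow> ln \<bar>of_int (u n)\<bar> \<le> c * n"
    proof eventually_elim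
      case (elim n)
      show ?case
      proof
        assume "u n \<noteq> 0"
        then have "ln (root n \<bar>of_int (u n)\<bar>) \<le> ln (exp c)"
          using elim by (intro ln_mono) auto
        then show "ln \<bar>of_int (u n)\<bar> \<le> c * n"
          using elim(1) by (simp add: ln_root field_simps)
      qed
    qed
  qed
qed

text \<open>The single test sequence \<open>Q n = n + 1\<close> suffices, since its consecutive
  logarithms have ratio tending to 1.\<close>

lemma dense_forms_T2:
  assumes T: "\<tau> \<in> T2_set \<xi>"
  shows "dense_forms \<xi> \<tau>"
proof -
  have \<tau>: "\<tau> > 0" using T by (simp add: T2_set_def)
  have "strict_mono Suc \<and> (\<forall>n. Suc n > 0)" by (simp add: strict_mono_def)
  then have "\<exists>u v :: nat \<Rightarrow> int.
        pow_o1_le (\<lambda>n. \<bar>real_of_int (u n)\<bar>) (\<lambda>n. real (Suc n)) 1 \<and>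
        pow_o1_eq (\<lambda>n. \<bar>real_of_int (u n) * \<xi> - real_of_int (v n)\<bar>) (\<lambda>n. real (Suc n)) (- \<tau>)"
    using T unfolding T2_set_def by blast
  then obtain u v :: "nat \<Rightarrow> int" and \<delta> \<delta>' where \<delta>: "\<delta> \<longlonglongrightarrow> 0" "\<delta>' \<longlonglongrightarrow> 0"
    and le: "\<And>n. \<bar>of_int (u n)\<bar> \<le> real (Suc n) powr (1 + \<delta> n)"
    and eq: "\<And>n. \<bar>of_int (u n) * \<xi> - of_int (v n)\<bar> = real (Suc n) powr (- \<tau> + \<delta>' n)"
    unfolding pow_o1_le_def pow_o1_eq_def by blast
  define s where "s n = ln (real (Suc n))" for n
  have sinf: "filterlim s at_top sequentially" unfolding s_def by real_asymp
  then have spos: "\<forall>\<^sub>F n in sequentially. s n > 0" by (simp add: filterlim_at_top_dense)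
  show ?thesis
  proof (rule dense_forms_of_scale[OF sinf _ _ \<tau> zero_less_one])
    show "(\<lambda>n. s (Suc n) / s n) \<longlonglongrightarrow> 1" unfolding s_def by real_asymp
    have "(\<lambda>n. \<tau> - \<delta>' n) \<longlonglongrightarrow> \<tau> - 0" by (intro tendsto_intros \<delta>)
    moreover have "\<forall>\<^sub>F n in sequentially. \<tau> - \<delta>' n = - ln \<bar>of_int (u n) * \<xi> - of_int (v n)\<bar> / s n"
      using spos
    proof eventually_elim
      case (elim n)
      have "ln \<bar>of_int (u n) * \<xi> - of_int (v n)\<bar> = (- \<tau> + \<delta>' n) * s n"
        by (simp only: eq s_def ln_powr)
      with elim show ?case by (simp add: field_simps)
    qed
    ultimately show "(\<lambda>n. - ln \<bar>of_int (u n) * \<xi> - of_int (v n)\<bar> / s n) \<longlonglongrightarrow> \<tau> * 1"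
      by (auto dest: Lim_transform_eventually)
    fix c :: real assume "c > 1"
    then have "\<forall>\<^sub>F n in sequentially. \<delta> n < c - 1" using \<delta>(1) by (intro order_tendstoD(2)) auto
    with spos show "\<forall>\<^sub>F n in sequentially. u n \<noteq> 0 \<longrightarrow> ln \<bar>of_int (u n)\<bar> \<le> c * s n"
    proof eventually_elim
      case (elim n)
      show ?case
      proof
        assume "u n \<noteq> 0"
        then have "ln \<bar>of_int (u n)\<bar> \<le> ln (real (Suc n) powr (1 + \<delta> n))"
          using le[of n] by (intro ln_mono) auto
        also have "\<dots> = (1 + \<delta> n) * s n" by (simp add: ln_powr s_def)
        also have "\<dots> \<le> c * s n" using elim by (intro mult_right_mono) auto
        finally show "ln \<bar>of_int (u n)\<bar> \<le> c * s n" .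
      qed
    qed
  qed
qed

subsection \<open>Linear forms with prescribed growth\<close>

text \<open>With \<open>N\<close> about \<open>Q powr \<sigma>\<close>, rounding changes the first
  coordinate by O(\<open>Q powr (\<sigma> * (m - 1))\<close>), which is o(\<open>Q\<close>) because
  \<open>\<sigma> * (m - 1) < 1\<close>. It changes the form by
  O(\<open>Q powr (- \<sigma>)\<close>), which is o(\<epsilon>) because
  \<open>\<sigma> > \<tau>\<close>.\<close>

lemma T3_memberI:
  assumes irr: "\<xi> \<notin> \<rat>" and m: "m \<in> exponents \<xi>" and \<tau>: "\<tau> > 0" "\<tau> * (m - 1) < 1"
  shows "\<tau> \<in> T3_set \<xi>"
proof -
  have m2: "m \<ge> 2" using exponents_ge_2[OF irr m] .
  obtain c where c: "c > 0"
    "\<And>p q::int. q \<ge> 1 \<Longrightarrow> c * of_int q powr (1 - m) \<le> \<bar>of_int q * \<xi> - of_int p\<bar>"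
    using exponents_lower_bound[OF irr m] by blast
  have "\<tau> < 1 / (m - 1)" using \<tau> m2 by (simp add: field_simps)
  then obtain \<sigma> where \<sigma>: "\<tau> < \<sigma>" "\<sigma> < 1 / (m - 1)" using dense by blast
  have \<sigma>m: "\<sigma> * (m - 1) < 1" using \<sigma> m2 by (simp add: field_simps)
  have "\<exists>u v :: nat \<Rightarrow> int. (\<lambda>n. of_int (u n) / Q n) \<longlonglongrightarrow> 1 \<and>
        (\<lambda>n. (of_int (u n) * \<xi> - of_int (v n)) / \<epsilon> n) \<longlonglongrightarrow> 1"
    if Q: "\<And>n. Q n > 0" "filterlim Q at_top sequentially" and \<epsilon>: "\<And>n. \<epsilon> n > 0"
      and ge: "pow_o1_ge \<epsilon> Q (- \<tau>)" for Q \<epsilon> :: "nat \<Rightarrow> real"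
  proof -
    obtain \<delta> where \<delta>: "\<delta> \<longlonglongrightarrow> 0" "\<And>n. \<epsilon> n \<ge> Q n powr (- \<tau> + \<delta> n)"
      using ge unfolding pow_o1_ge_def by blast
    define C where "C = 1 / c + 1"
    have C: "C > 0" using c(1) by (simp add: C_def add_pos_pos)
    define N where "N n = nat \<lceil>Q n powr \<sigma>\<rceil>" for n
    have N: "N n > 0" "real (N n) \<ge> Q n powr \<sigma>" "real (N n) \<le> Q n powr \<sigma> + 1" for n
    proof -
      have "Q n powr \<sigma> > 0" using Q(1)[of n] by simp
      then show "N n > 0" "real (N n) \<ge> Q n powr \<sigma>" "real (N n) \<le> Q n powr \<sigma> + 1"
        unfolding N_def by linarith+
    qed
    have "\<exists>u v :: int. \<bar>of_int u - Q n\<bar> \<le> 2 * C * real (N n) powr (m - 1) \<and>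
        \<bar>of_int u * \<xi> - of_int v - \<epsilon> n\<bar> \<le> 2 / N n" for n
    proof -
      obtain p q p' q' :: int where pq: "q * p' \<noteq> q' * p"
        "\<bar>of_int q\<bar> \<le> C * real (N n) powr (m - 1)" "\<bar>of_int q * \<xi> - of_int p\<bar> \<le> 1 / N n"
        "\<bar>of_int q'\<bar> \<le> C * real (N n) powr (m - 1)" "\<bar>of_int q' * \<xi> - of_int p'\<bar> \<le> 1 / N n"
        using two_independent_forms[OF c(2) c(1) m2 N(1)] unfolding C_def by metis
      obtain u v :: int where "\<bar>of_int u - Q n\<bar> \<le> \<bar>of_int q\<bar> + \<bar>of_int q'\<bar>"
        "\<bar>of_int u * \<xi> - of_int v - \<epsilon> n\<bar> \<le> \<bar>of_int q * \<xi> - of_int p\<bar> + \<bar>of_int q' * \<xi> - of_int p'\<bar>"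
        using round_to_lattice[OF pq(1)] by metis
      with pq show ?thesis by (intro exI[of _ u] exI[of _ v]) auto
    qed
    then obtain u v :: "nat \<Rightarrow> int" where
      u: "\<And>n. \<bar>of_int (u n) - Q n\<bar> \<le> 2 * C * real (N n) powr (m - 1)" and
      v: "\<And>n. \<bar>of_int (u n) * \<xi> - of_int (v n) - \<epsilon> n\<bar> \<le> 2 / N n"
      by metis
    have Q1: "\<forall>\<^sub>F n in sequentially. Q n \<ge> 1" using Q(2) by (simp add: filterlim_at_top)
    have "(\<lambda>n. of_int (u n) / Q n) \<longlonglongrightarrow> 1"
    proof (rule LIM_zero_cancel, rule Lim_null_comparison)
      have "(\<lambda>n. Q n powr (\<sigma> * (m - 1) - 1)) \<longlonglongrightarrow> 0"
        using \<sigma>m by (intro tendsto_neg_powr Q(2)) auto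
      then show "(\<lambda>n. 2 * C * 2 powr (m - 1) * Q n powr (\<sigma> * (m - 1) - 1)) \<longlonglongrightarrow> 0"
        by (rule tendsto_mult_right_zero)
      show "\<forall>\<^sub>F n in sequentially. norm (of_int (u n) / Q n - 1) \<le> 2 * C * 2 powr (m - 1) * Q n powr (\<sigma> * (m - 1) - 1)"
        using Q1
      proof eventually_elim
        case (elim n)
        \<comment> \<open>Once \<open>Q n \<ge> 1\<close>, rounding \<open>Q n powr \<sigma>\<close>
          up at most doubles it; this produces the constant \<open>2 powr (m - 1)\<close>.\<close>
        have "1 \<le> Q n powr \<sigma>" using elim \<sigma> \<tau> by (simp add: ge_one_powr_ge_zero)
        then have "real (N n) \<le> 2 * Q n powr \<sigma>" using N(3)[of n] by linarith
        then have "real (N n) powr (m - 1) \<le> (2 * Q n powr \<sigma>) powr (m - 1)"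
          using m2 by (intro powr_mono2) auto
        also have "\<dots> = 2 powr (m - 1) * Q n powr (\<sigma> * (m - 1))"
          by (simp add: powr_mult powr_powr)
        finally have "2 * C * real (N n) powr (m - 1) / Q n \<le> 2 * C * (2 powr (m - 1) * Q n powr (\<sigma> * (m - 1))) / Q n"
          using C Q(1)[of n] by (intro divide_right_mono mult_left_mono) auto
        also have "\<dots> = 2 * C * 2 powr (m - 1) * Q n powr (\<sigma> * (m - 1) - 1)"
          using Q(1)[of n] by (simp add: powr_diff)
        finally have "2 * C * real (N n) powr (m - 1) / Q n \<le> \<dots>" .
        moreover have "norm (of_int (u n) / Q n - 1) = \<bar>of_int (u n) - Q n\<bar> / Q n"
        proof -
          have "of_int (u n) / Q n - 1 = (of_int (u n) - Q n) / Q n"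
            using Q(1)[of n] by (simp add: field_simps)
          then show ?thesis using Q(1)[of n] by (simp add: abs_divide)
        qed
        moreover have "\<bar>of_int (u n) - Q n\<bar> / Q n \<le> 2 * C * real (N n) powr (m - 1) / Q n"
          using u[of n] Q(1)[of n] by (intro divide_right_mono) auto
        ultimately show ?case by linarith
      qed
    qed
    moreover have "(\<lambda>n. (of_int (u n) * \<xi> - of_int (v n)) / \<epsilon> n) \<longlonglongrightarrow> 1"
    proof (rule LIM_zero_cancel, rule Lim_null_comparison)
      have "(\<lambda>n. Q n powr ((\<tau> - \<sigma>) / 2)) \<longlonglongrightarrow> 0"
        using \<sigma> by (intro tendsto_neg_powr Q(2)) auto
      then show "(\<lambda>n. 2 * Q n powr ((\<tau> - \<sigma>) / 2)) \<longlonglongrightarrow> 0"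
        by (rule tendsto_mult_right_zero)
      \<comment> \<open>Half of the gap between \<tau> and \<sigma> absorbs
        \<open>\<delta> n\<close>; the other half is the rate of decay.\<close>
      have "\<forall>\<^sub>F n in sequentially. \<delta> n > (\<tau> - \<sigma>) / 2"
        using \<delta>(1) \<sigma> by (intro order_tendstoD(1)) auto
      with Q1 show "\<forall>\<^sub>F n in sequentially. norm ((of_int (u n) * \<xi> - of_int (v n)) / \<epsilon> n - 1) \<le> 2 * Q n powr ((\<tau> - \<sigma>) / 2)"
      proof eventually_elim
        case (elim n)
        have "(of_int (u n) * \<xi> - of_int (v n)) / \<epsilon> n - 1 = (of_int (u n) * \<xi> - of_int (v n) - \<epsilon> n) / \<epsilon> n"
          using \<epsilon>[of n] by (simp add: field_simps)
        then have "norm ((of_int (u n) * \<xi> - of_int (v n)) / \<epsilon> n - 1) = \<bar>of_int (u n) * \<xi> - of_int (v n) - \<epsilon> n\<bar> / \<epsilon> n"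
          using \<epsilon>[of n] by (simp add: abs_divide)
        also have "\<dots> \<le> (2 / N n) / Q n powr (- \<tau> + \<delta> n)"
          using v[of n] \<delta>(2)[of n] Q(1)[of n] by (intro frac_le) auto
        also have "\<dots> \<le> (2 / Q n powr \<sigma>) / Q n powr (- \<tau> + \<delta> n)"
          using N[of n] Q(1)[of n] by (intro divide_right_mono divide_left_mono) auto
        also have "\<dots> = 2 * Q n powr (\<tau> - \<delta> n - \<sigma>)"
          by (simp add: powr_diff powr_minus powr_add field_simps)
        also have "\<dots> \<le> 2 * Q n powr ((\<tau> - \<sigma>) / 2)"
          using elim by (intro mult_left_mono powr_mono) (auto simp: field_simps)
        finally show ?case .
      qed
    qed
    ultimately show ?thesis by blast
  qed
  then show ?thesis using \<tau>(1) unfolding T3_set_def by blast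
qed

section \<open>Inclusion of \<open>T3_set\<close> in the other three sets\<close>

lemma ln_ratio_limit:
  fixes a b s :: "nat \<Rightarrow> real"
  assumes lim: "(\<lambda>n. a n / b n) \<longlonglongrightarrow> 1" and s: "filterlim s at_top sequentially"
    and b: "\<And>n. b n > 0" "\<And>n. ln (b n) = k * s n"
  shows "(\<lambda>n. ln (a n) / s n) \<longlonglongrightarrow> k" "\<forall>\<^sub>F n in sequentially. a n > 0"
proof -
  have "\<forall>\<^sub>F n in sequentially. a n / b n > 0" using lim by (rule order_tendstoD) simp
  then show apos: "\<forall>\<^sub>F n in sequentially. a n > 0"
    by eventually_elim (use b(1) in \<open>auto simp: zero_less_divide_iff dest: less_asym\<close>)
  have spos: "\<forall>\<^sub>F n in sequentially. s n > 0" using s by (simp add: filterlim_at_top_dense)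
  have "(\<lambda>n. ln (a n / b n)) \<longlonglongrightarrow> ln 1" by (intro tendsto_intros lim) auto
  then have "(\<lambda>n. ln (a n / b n) / s n) \<longlonglongrightarrow> 0"
    by (rule real_tendsto_divide_at_top) (rule s)
  then have "(\<lambda>n. ln (a n / b n) / s n + k) \<longlonglongrightarrow> 0 + k" by (intro tendsto_intros)
  moreover have "\<forall>\<^sub>F n in sequentially. ln (a n / b n) / s n + k = ln (a n) / s n"
    using apos spos
  proof eventually_elim
    case (elim n)
    then show ?case using b(1)[of n] by (simp add: ln_div b(2) field_simps)
  qed
  ultimately show "(\<lambda>n. ln (a n) / s n) \<longlonglongrightarrow> k" by (auto dest: Lim_transform_eventually)
qed

text \<open>The target \<open>\<epsilon> = Q powr (- \<tau>)\<close> is admissible with zero error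
  exponent, and both asymptotic equivalences become limits of logarithmic ratios. The bound
  \<open>u n \<ge> 2\<close> makes \<open>ln (u n)\<close> positive, so that it may be divided
  by.\<close>

lemma T3_sequences:
  fixes Q :: "nat \<Rightarrow> real"
  assumes T: "\<tau> \<in> T3_set \<xi>" and Q: "\<And>n. Q n > 0" "filterlim Q at_top sequentially"
  obtains u v :: "nat \<Rightarrow> int" where
    "(\<lambda>n. ln (of_int (u n)) / ln (Q n)) \<longlonglongrightarrow> 1"
    "(\<lambda>n. ln \<bar>of_int (u n) * \<xi> - of_int (v n)\<bar> / ln (Q n)) \<longlonglongrightarrow> - \<tau>"
    "\<forall>\<^sub>F n in sequentially. u n \<ge> 2 \<and> \<bar>of_int (u n) * \<xi> - of_int (v n)\<bar> > 0"
proof -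
  have \<tau>: "\<tau> > 0" using T by (simp add: T3_set_def)
  define \<epsilon> where "\<epsilon> n = Q n powr (- \<tau>)" for n
  have "\<epsilon> \<longlonglongrightarrow> 0" unfolding \<epsilon>_def using \<tau> by (intro tendsto_neg_powr Q(2)) auto
  moreover have "\<forall>n. \<epsilon> n > 0" using Q(1) by (simp add: \<epsilon>_def less_imp_neq[OF Q(1), symmetric])
  moreover have "pow_o1_ge \<epsilon> Q (- \<tau>)"
    unfolding pow_o1_ge_def by (rule exI[of _ "\<lambda>_. 0"]) (simp add: \<epsilon>_def)
  ultimately obtain u v :: "nat \<Rightarrow> int" where
    u: "(\<lambda>n. of_int (u n) / Q n) \<longlonglongrightarrow> 1" and
    v: "(\<lambda>n. (of_int (u n) * \<xi> - of_int (v n)) / \<epsilon> n) \<longlonglongrightarrow> 1"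
    using T Q unfolding T3_set_def by blast
  have s: "filterlim (\<lambda>n. ln (Q n)) at_top sequentially"
    by (rule filterlim_compose[OF ln_at_top Q(2)])
  have v': "(\<lambda>n. \<bar>of_int (u n) * \<xi> - of_int (v n)\<bar> / \<epsilon> n) \<longlonglongrightarrow> 1"
    using tendsto_rabs[OF v] by (simp add: \<epsilon>_def abs_divide)
  have "ln (\<epsilon> n) = - \<tau> * ln (Q n)" for n using Q(1)[of n] by (simp add: \<epsilon>_def ln_powr)
  note V = ln_ratio_limit[OF v' s \<open>\<forall>n. \<epsilon> n > 0\<close>[rule_format] this]
  have "filterlim (\<lambda>n. of_int (u n) / Q n * Q n) at_top sequentially"
    by (rule filterlim_tendsto_pos_mult_at_top[OF u _ Q(2)]) simp
  then have "filterlim (\<lambda>n. real_of_int (u n)) at_top sequentially"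
    by (simp add: less_imp_neq[OF Q(1), symmetric])
  then have "\<forall>\<^sub>F n in sequentially. real_of_int (u n) \<ge> 2"
    unfolding filterlim_at_top by blast
  then have "\<forall>\<^sub>F n in sequentially. u n \<ge> 2" by simp
  with V(2) have "\<forall>\<^sub>F n in sequentially. u n \<ge> 2 \<and> \<bar>of_int (u n) * \<xi> - of_int (v n)\<bar> > 0"
    by eventually_elim simp
  moreover have "(\<lambda>n. ln (of_int (u n)) / ln (Q n)) \<longlonglongrightarrow> 1"
    by (rule ln_ratio_limit(1)[OF u s Q(1)]) simp
  ultimately show thesis using that V(1) by blast
qed

lemma T3_subset_T2: "T3_set \<xi> \<subseteq> T2_set \<xi>"
proof
  fix \<tau> assume T: "\<tau> \<in> T3_set \<xi>"
  then have \<tau>: "\<tau> > 0" by (simp add: T3_set_def)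
  have "\<exists>u v :: nat \<Rightarrow> int.
        pow_o1_le (\<lambda>n. \<bar>real_of_int (u n)\<bar>) (\<lambda>n. real (Q n)) 1 \<and>
        pow_o1_eq (\<lambda>n. \<bar>real_of_int (u n) * \<xi> - real_of_int (v n)\<bar>) (\<lambda>n. real (Q n)) (- \<tau>)"
    if Q: "strict_mono Q" "\<And>n. Q n > 0" for Q :: "nat \<Rightarrow> nat"
  proof -
    have Qinf: "filterlim (\<lambda>n. real (Q n)) at_top sequentially"
      using filterlim_compose[OF filterlim_real_sequentially filterlim_subseq[OF Q(1)]] .
    have Qpos: "real (Q n) > 0" for n using Q(2) by simp
    obtain u v :: "nat \<Rightarrow> int" where
      u: "(\<lambda>n. ln (of_int (u n)) / ln (real (Q n))) \<longlonglongrightarrow> 1" and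
      v: "(\<lambda>n. ln \<bar>of_int (u n) * \<xi> - of_int (v n)\<bar> / ln (real (Q n))) \<longlonglongrightarrow> - \<tau>" and
      pos: "\<forall>\<^sub>F n in sequentially. u n \<ge> 2 \<and> \<bar>of_int (u n) * \<xi> - of_int (v n)\<bar> > 0"
      by (rule T3_sequences[OF T Qpos Qinf])
    \<comment> \<open>The condition \<open>Q n > 1\<close> makes \<open>ln (Q n)\<close> nonzero, so
      the exponents below can be defined by quotients of logarithms.\<close>
    define G where "G n \<longleftrightarrow> u n \<ge> 2 \<and> \<bar>of_int (u n) * \<xi> - of_int (v n)\<bar> > 0 \<and> Q n > 1" for n
    have "\<forall>\<^sub>F n in sequentially. real (Q n) > 1" using Qinf unfolding filterlim_at_top_dense by blast
    with pos have G: "eventually G sequentially"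
      by eventually_elim (auto simp: G_def)
    \<comment> \<open>The equality is required for every \<open>n\<close>, including \<open>Q n = 1\<close>; the form \<open>0 \<xi> - 1\<close> works at the
      finitely many bad \<open>n\<close>.\<close>
    define u' where "u' n = (if G n then u n else 0)" for n
    define v' where "v' n = (if G n then v n else 1)" for n
    define \<delta> where "\<delta> n = (if G n then ln (of_int (u n)) / ln (real (Q n)) - 1 else 0)" for n
    \<comment> \<open>At bad indices the value \<tau> makes the exponent
      \<open>- \<tau> + \<delta>' n\<close> zero, in agreement with a form of absolute value
      1.\<close>
    define \<delta>' where "\<delta>' n = (if G n then ln \<bar>of_int (u n) * \<xi> - of_int (v n)\<bar> / ln (real (Q n)) + \<tau> else \<tau>)" for n
    have "(\<lambda>n. ln (of_int (u n)) / ln (real (Q n)) - 1) \<longlonglongrightarrow> 1 - 1" by (intro tendsto_intros u)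
    then have "\<delta> \<longlonglongrightarrow> 1 - 1"
      by (rule Lim_transform_eventually) (use G in eventually_elim, simp add: \<delta>_def)
    moreover have "\<bar>of_int (u' n)\<bar> \<le> real (Q n) powr (1 + \<delta> n)" for n
      by (auto simp: u'_def \<delta>_def G_def powr_def)
    ultimately have 1: "pow_o1_le (\<lambda>n. \<bar>real_of_int (u' n)\<bar>) (\<lambda>n. real (Q n)) 1"
      unfolding pow_o1_le_def by auto
    have "(\<lambda>n. ln \<bar>of_int (u n) * \<xi> - of_int (v n)\<bar> / ln (real (Q n)) + \<tau>) \<longlonglongrightarrow> - \<tau> + \<tau>"
      by (intro tendsto_intros v)
    then have "\<delta>' \<longlonglongrightarrow> - \<tau> + \<tau>"
      by (rule Lim_transform_eventually) (use G in eventually_elim, simp add: \<delta>'_def)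
    moreover have "\<bar>of_int (u' n) * \<xi> - of_int (v' n)\<bar> = real (Q n) powr (- \<tau> + \<delta>' n)" for n
      using Q(2)[of n] by (auto simp: u'_def v'_def \<delta>'_def G_def powr_def)
    ultimately have 2: "pow_o1_eq (\<lambda>n. \<bar>real_of_int (u' n) * \<xi> - real_of_int (v' n)\<bar>) (\<lambda>n. real (Q n)) (- \<tau>)"
      unfolding pow_o1_eq_def by auto
    from 1 2 show ?thesis by blast
  qed
  then show "\<tau> \<in> T2_set \<xi>" using \<tau> unfolding T2_set_def by blast
qed

text \<open>For \<open>Q n = 2 ^ n\<close>, taking the n-th root amounts to exponentiating the
  logarithmic ratio times \<open>ln 2\<close>. The limits are therefore \<open>\<beta> = 2\<close>
  and \<open>\<alpha> = 2 powr (- \<tau>)\<close>.\<close>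

lemma T3_subset_T1: "T3_set \<xi> \<subseteq> T1_set \<xi>"
proof
  fix \<tau> assume T: "\<tau> \<in> T3_set \<xi>"
  then have \<tau>: "\<tau> > 0" by (simp add: T3_set_def)
  have Qinf: "filterlim (\<lambda>n::nat. 2 ^ n :: real) at_top sequentially" by real_asymp
  obtain u v :: "nat \<Rightarrow> int" where
    u: "(\<lambda>n. ln (real_of_int (u n)) / ln (2 ^ n)) \<longlonglongrightarrow> 1" and
    v: "(\<lambda>n. ln \<bar>of_int (u n) * \<xi> - of_int (v n)\<bar> / ln (2 ^ n)) \<longlonglongrightarrow> - \<tau>" and
    pos: "\<forall>\<^sub>F n in sequentially. u n \<ge> 2 \<and> \<bar>of_int (u n) * \<xi> - of_int (v n)\<bar> > 0"
    using T3_sequences[OF T _ Qinf] by auto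
  have root_eq: "root n x = exp (ln x / ln (2 ^ n) * ln 2)" if "n > 0" "x > 0" for n and x :: real
    using that by (simp add: root_powr_inverse powr_def ln_realpow)
  have "(\<lambda>n. exp (ln (real_of_int (u n)) / ln (2 ^ n) * ln 2)) \<longlonglongrightarrow> exp (1 * ln 2)"
    by (intro tendsto_intros u)
  moreover have "\<forall>\<^sub>F n in sequentially. exp (ln (real_of_int (u n)) / ln (2 ^ n) * ln 2) = root n \<bar>of_int (u n)\<bar>"
    using pos eventually_gt_at_top[of 0] by eventually_elim (simp add: root_eq)
  ultimately have "(\<lambda>n. root n \<bar>of_int (u n)\<bar>) \<longlonglongrightarrow> exp (1 * ln 2)"
    by (rule Lim_transform_eventually)
  then have "limsup (\<lambda>n. ereal (root n \<bar>of_int (u n)\<bar>)) = ereal 2"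
    by (intro lim_imp_Limsup) auto
  then have 1: "limsup (\<lambda>n. ereal (root n \<bar>of_int (u n)\<bar>)) \<le> ereal 2" by simp
  have "(\<lambda>n. exp (ln \<bar>of_int (u n) * \<xi> - of_int (v n)\<bar> / ln (2 ^ n) * ln 2)) \<longlonglongrightarrow> exp (- \<tau> * ln 2)"
    by (intro tendsto_intros v)
  moreover have "\<forall>\<^sub>F n in sequentially. exp (ln \<bar>of_int (u n) * \<xi> - of_int (v n)\<bar> / ln (2 ^ n) * ln 2)
      = root n \<bar>of_int (u n) * \<xi> - of_int (v n)\<bar>"
    using pos eventually_gt_at_top[of 0] by eventually_elim (subst root_eq, auto)
  ultimately have 2: "(\<lambda>n. root n \<bar>of_int (u n) * \<xi> - of_int (v n)\<bar>) \<longlonglongrightarrow> exp (- \<tau> * ln 2)"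
    by (rule Lim_transform_eventually)
  have "exp (- \<tau> * ln 2) < 1" "\<tau> = - ln (exp (- \<tau> * ln 2)) / ln 2" using \<tau> by auto
  with 1 2 \<tau> show "\<tau> \<in> T1_set \<xi>"
    unfolding T1_set_def
    by (intro CollectI conjI exI[of _ u] exI[of _ v] exI[of _ "exp (- \<tau> * ln 2)"] exI[of _ 2]) auto
qed

text \<open>The sequence \<open>Q n = 2 ^ n\<close> is chosen because its logarithms are
  proportional to \<open>n\<close>, so consecutive forms have logarithms with ratio tending to
  1.\<close>

lemma T3_subset_T0:
  assumes irr: "\<xi> \<notin> \<rat>"
  shows "T3_set \<xi> \<subseteq> T0_set \<xi>"
proof
  fix \<tau> assume T: "\<tau> \<in> T3_set \<xi>"
  then have \<tau>: "\<tau> > 0" by (simp add: T3_set_def)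
  define s where "s n = ln (2 ^ n :: real)" for n :: nat
  have Qinf: "filterlim (\<lambda>n::nat. 2 ^ n :: real) at_top sequentially" by real_asymp
  obtain u v :: "nat \<Rightarrow> int" where
    u: "(\<lambda>n. ln (of_int (u n)) / s n) \<longlonglongrightarrow> 1" and
    v: "(\<lambda>n. ln \<bar>of_int (u n) * \<xi> - of_int (v n)\<bar> / s n) \<longlonglongrightarrow> - \<tau>" and
    pos: "\<forall>\<^sub>F n in sequentially. u n \<ge> 2 \<and> \<bar>of_int (u n) * \<xi> - of_int (v n)\<bar> > 0"
    using T3_sequences[OF T _ Qinf] unfolding s_def by auto
  have s: "filterlim s at_top sequentially" "(\<lambda>n. s (Suc n) / s n) \<longlonglongrightarrow> 1"
    unfolding s_def by real_asymp+
  define x where "x n = \<bar>of_int (u n) * \<xi> - of_int (v n)\<bar>" for n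
  define L where "L n = - ln (x n)" for n
  have "(\<lambda>n. L n / s n) \<longlonglongrightarrow> \<tau>"
    using tendsto_minus[OF v] by (simp add: L_def x_def)
  note L = asymptotic_ratio[OF this \<tau> s]
  have "\<forall>\<^sub>F n in sequentially. L n > 0" using L(1) by (simp add: filterlim_at_top_dense)
  with pos have "\<forall>\<^sub>F n in sequentially. u n \<ge> 2 \<and> x n > 0 \<and> L n > 0"
    by eventually_elim (simp add: x_def)
  then obtain N where N: "\<And>n. n \<ge> N \<Longrightarrow> u n \<ge> 2" "\<And>n. n \<ge> N \<Longrightarrow> x n > 0" "\<And>n. n \<ge> N \<Longrightarrow> L n > 0"
    by (auto simp: eventually_sequentially)
  have "filterlim (\<lambda>n. ln (x n)) at_bot sequentially"
    using L(1) by (simp add: L_def[abs_def] filterlim_uminus_at_bot)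
  then have "(\<lambda>n. exp (ln (x n))) \<longlonglongrightarrow> 0"
    by (rule filterlim_compose[OF exp_at_bot])
  moreover have "\<forall>\<^sub>F n in sequentially. exp (ln (x n)) = x n"
    using eventually_ge_at_top[of N] by eventually_elim (simp add: N)
  ultimately have "x \<longlonglongrightarrow> 0" by (rule Lim_transform_eventually)
  then have x0: "(\<lambda>n. of_int (u n) * \<xi> - of_int (v n)) \<longlonglongrightarrow> 0"
    by (simp add: x_def[abs_def] tendsto_rabs_zero_iff)
  define \<delta> where "\<delta> n = L (Suc n) / L n - 1" for n
  have "\<delta> \<longlonglongrightarrow> 1 - 1" unfolding \<delta>_def by (intro tendsto_intros L(2))
  then have \<delta>: "\<delta> \<longlonglongrightarrow> 0" by simp
  have eq: "x (Suc n) = x n powr (1 + \<delta> n)" if "n \<ge> N" for n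
    using N(2)[of n] N(2)[of "Suc n"] N(3)[of n] that by (simp add: powr_def \<delta>_def L_def)
  \<comment> \<open>This makes \<open>- \<tau> + \<delta>' n\<close> equal to
    \<open>ln (x n) / ln (u n)\<close>, so the required inequality even holds with equality;
    dividing both logarithms by \<open>s n\<close> exposes the limit.\<close>
  define \<delta>' where "\<delta>' n = (ln (x n) / s n) / (ln (of_int (u n)) / s n) + \<tau>" for n
  have "\<delta>' \<longlonglongrightarrow> - \<tau> / 1 + \<tau>" unfolding \<delta>'_def x_def by (intro tendsto_intros u v) simp
  then have \<delta>': "\<delta>' \<longlonglongrightarrow> 0" by simp
  have le: "x n \<le> of_int (u n) powr (- \<tau> + \<delta>' n)" if "n \<ge> max N 1" for n
  proof -
    have "s n > 0" "ln (real_of_int (u n)) > 0" using that N(1)[of n] by (auto simp: s_def)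
    then show ?thesis using N(1,2)[of n] that by (simp add: \<delta>'_def powr_def)
  qed
  \<comment> \<open>The sequences are shifted because the conditions must hold at every index. At
    least 1 is needed since \<open>s 0 = 0\<close>.\<close>
  define M where "M = max N 1"
  define u' v' where "u' n = u (n + M)" and "v' n = v (n + M)" for n
  have NM: "n + M \<ge> N" "n + M \<ge> max N 1" for n by (simp_all add: M_def)
  have "u' n \<noteq> 0" for n using N(1)[OF NM(1)[of n]] by (simp add: u'_def)
  then have "\<forall>n. u' n \<noteq> 0" by blast
  moreover have "(\<lambda>n. of_int (u' n) * \<xi> - of_int (v' n)) \<longlonglongrightarrow> 0"
    unfolding u'_def v'_def by (rule LIMSEQ_ignore_initial_segment[OF x0])
  moreover have "pow_o1_eq (\<lambda>n. \<bar>of_int (u' (Suc n)) * \<xi> - of_int (v' (Suc n))\<bar>)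
      (\<lambda>n. \<bar>of_int (u' n) * \<xi> - of_int (v' n)\<bar>) 1"
    unfolding pow_o1_eq_def
    using LIMSEQ_ignore_initial_segment[OF \<delta>, of M] eq
    by (intro exI[of _ "\<lambda>n. \<delta> (n + M)"]) (auto simp: u'_def v'_def x_def M_def)
  moreover have "pow_o1_le (\<lambda>n. \<bar>of_int (u' n) * \<xi> - of_int (v' n)\<bar>) (\<lambda>n. \<bar>of_int (u' n)\<bar>) (- \<tau>)"
  proof -
    have "\<bar>real_of_int (u (n + M))\<bar> = real_of_int (u (n + M))" for n
      using N(1)[OF NM(1)[of n]] by simp
    then show ?thesis
      unfolding pow_o1_le_def
      using LIMSEQ_ignore_initial_segment[OF \<delta>', of M] le[OF NM(2)]
      by (intro exI[of _ "\<lambda>n. \<delta>' (n + M)"]) (simp add: u'_def v'_def x_def)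
  qed
  ultimately show "\<tau> \<in> T0_set \<xi>" using \<tau> unfolding T0_set_def by blast
qed

subsection \<open>The four suprema\<close>

lemma irrationality_exponent_ge_2:
  assumes "\<xi> \<notin> \<rat>"
  shows "irrationality_exponent \<xi> \<ge> 2"
  unfolding irrationality_exponent_eq_Inf
proof (rule Inf_greatest)
  fix y assume "y \<in> ereal ` exponents \<xi>"
  then obtain m where "y = ereal m" "m \<in> exponents \<xi>" by blast
  then show "2 \<le> y" using exponents_ge_2[OF assms, of m]
    by (metis ereal_less_eq(3) numeral_eq_ereal)
qed

lemma irrationality_exponent_cases:
  assumes "\<xi> \<notin> \<rat>"
  obtains "irrationality_exponent \<xi> = \<infinity>" "1 / (irrationality_exponent \<xi> - 1) = 0"
  | r where "irrationality_exponent \<xi> = ereal r" "r \<ge> 2"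
      "1 / (irrationality_exponent \<xi> - 1) = ereal (1 / (r - 1))"
proof (cases "irrationality_exponent \<xi>")
  case (real r)
  then have "ereal 2 \<le> ereal r" using irrationality_exponent_ge_2[OF assms] by simp
  then have "r \<ge> 2" by simp
  moreover have "1 / (irrationality_exponent \<xi> - 1) = ereal (1 / (r - 1))"
    using \<open>r \<ge> 2\<close> unfolding real one_ereal_def by simp
  ultimately show thesis using that real by blast
next
  case PInf
  then show thesis using that by simp
next
  case MInf
  then show thesis using irrationality_exponent_ge_2[OF assms] by simp
qed

text \<open>If the irrationality exponent exceeded \<open>1 + 1 / \<tau>\<close>, a real
  \<open>m\<close> strictly between them would be an admissible exponent below the infimum.\<close>

lemma dense_forms_le:
  assumes irr: "\<xi> \<notin> \<rat>" and d: "dense_forms \<xi> \<tau>" and \<tau>: "\<tau> > 0"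
  shows "ereal \<tau> \<le> 1 / (irrationality_exponent \<xi> - 1)"
proof -
  have le: "irrationality_exponent \<xi> \<le> ereal (1 + 1 / \<tau>)"
  proof (rule ccontr)
    assume "\<not> ?thesis"
    then obtain m where m: "ereal (1 + 1 / \<tau>) < ereal m" "ereal m < irrationality_exponent \<xi>"
      using ereal_dense2[of "ereal (1 + 1 / \<tau>)" "irrationality_exponent \<xi>"] by (auto simp: not_le)
    then have "m \<in> exponents \<xi>" using dense_forms_exponents[OF d \<tau>] by simp
    then have "irrationality_exponent \<xi> \<le> ereal m"
      unfolding irrationality_exponent_eq_Inf by (simp add: Inf_lower)
    with m(2) show False by simp
  qed
  show ?thesis
  proof (cases rule: irrationality_exponent_cases[OF irr])
    case 1
    then show ?thesis using le by simp
  next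
    case (2 r)
    then have "r - 1 \<le> 1 / \<tau>" using le by simp
    then have "\<tau> \<le> 1 / (r - 1)" using 2(2) \<tau> by (simp add: field_simps)
    then show ?thesis unfolding 2(3) by simp
  qed
qed

lemma T3_memberI_less:
  assumes irr: "\<xi> \<notin> \<rat>" and \<tau>: "\<tau> > 0" and less: "ereal \<tau> < 1 / (irrationality_exponent \<xi> - 1)"
  shows "\<tau> \<in> T3_set \<xi>"
proof (cases rule: irrationality_exponent_cases[OF irr])
  case 1
  then show ?thesis using \<tau> less by simp
next
  case (2 r)
  then have "\<tau> < 1 / (r - 1)" using less by simp
  then have "r < 1 + 1 / \<tau>" using 2(2) \<tau> by (simp add: field_simps)
  then have "Inf (ereal ` exponents \<xi>) < ereal (1 + 1 / \<tau>)"
    using 2(1) by (simp add: irrationality_exponent_eq_Inf)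
  then obtain m where "m \<in> exponents \<xi>" "m < 1 + 1 / \<tau>" by (auto simp: Inf_less_iff)
  then show ?thesis using \<tau> by (intro T3_memberI[OF irr]) (auto simp: field_simps)
qed

text \<open>The convention for the empty set is consistent: if \<open>S\<close> is empty, no
  positive real lies below \<open>B\<close>, which forces \<open>B = 0\<close>.\<close>

lemma sup0_eqI:
  assumes B: "0 \<le> B" and upper: "\<And>t. t \<in> S \<Longrightarrow> t > 0 \<and> ereal t \<le> B"
    and lower: "\<And>t. t > 0 \<Longrightarrow> ereal t < B \<Longrightarrow> t \<in> S"
  shows "sup0 S = B"
proof (cases "S = {}")
  case True
  have "B \<le> 0"
  proof (rule ccontr)
    assume "\<not> B \<le> 0"
    then obtain z where "0 < ereal z" "ereal z < B" using ereal_dense2[of 0 B] by (auto simp: not_le)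
    then show False using lower[of z] True by simp
  qed
  with B True show ?thesis by (simp add: sup0_def)
next
  case False
  then obtain t where t: "t \<in> S" by blast
  have "0 \<le> ereal t" using upper[OF t] by simp
  also have "\<dots> \<le> Sup (ereal ` S)" using t by (simp add: Sup_upper)
  finally have nonneg: "0 \<le> Sup (ereal ` S)" .
  have "B \<le> Sup (ereal ` S)"
  proof (rule ccontr)
    assume "\<not> ?thesis"
    then obtain z where z: "Sup (ereal ` S) < ereal z" "ereal z < B"
      using ereal_dense2[of "Sup (ereal ` S)" B] by (auto simp: not_le)
    have "0 < ereal z" using nonneg z(1) by (rule order_le_less_trans)
    then have "z \<in> S" using lower z(2) by simp
    then have "ereal z \<le> Sup (ereal ` S)" by (simp add: Sup_upper)
    with z(1) show False by simp
  qed
  moreover have "Sup (ereal ` S) \<le> B" using upper by (auto intro: Sup_least)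
  ultimately show ?thesis using False by (simp add: sup0_def)
qed

text \<open>Liouville approximations need only \<open>q \<ge> 2\<close>, whereas exponents concern
  large \<open>q\<close>. The uniform lower bound with constant \<open>c\<close> bridges this, since
  powers of \<open>q \<ge> 2\<close> can absorb \<open>c\<close>.\<close>

lemma Liouville_number_iff:
  assumes irr: "\<xi> \<notin> \<rat>"
  shows "Liouville_number \<xi> \<longleftrightarrow> irrationality_exponent \<xi> = \<infinity>"
proof
  assume L: "Liouville_number \<xi>"
  have "exponents \<xi> = {}"
  proof (rule ccontr)
    assume "exponents \<xi> \<noteq> {}"
    then obtain m where m: "m \<in> exponents \<xi>" by blast
    obtain c where c: "c > 0"
      "\<And>p q::int. q \<ge> 1 \<Longrightarrow> c * of_int q powr (1 - m) \<le> \<bar>of_int q * \<xi> - of_int p\<bar>"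
      using exponents_lower_bound[OF irr m] by blast
    \<comment> \<open>The increment makes \<open>2 powr (M - m)\<close> at least
      \<open>1 / c\<close>; it is kept nonnegative so that the bound passes from 2 to
      \<open>q\<close>.\<close>
    define M where "M = m + max 0 (log 2 (1 / c))"
    have "m \<ge> 2" using exponents_ge_2[OF irr m] .
    then have "M > 0" by (simp add: M_def)
    then obtain p q :: int where q: "q \<ge> 2" and less: "\<bar>\<xi> - of_int p / of_int q\<bar> < of_int q powr (- M)"
      using L unfolding Liouville_number_def by blast
    have "1 / c = 2 powr log 2 (1 / c)" using c(1) by simp
    also have "\<dots> \<le> 2 powr (M - m)" by (intro powr_mono) (auto simp: M_def)
    also have "\<dots> \<le> of_int q powr (M - m)" using q by (intro powr_mono2) (auto simp: M_def)
    finally have "of_int q powr (m - M) \<le> c"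
      using c(1) q by (simp add: powr_diff field_simps)
    have "of_int q powr (1 - M) = of_int q powr (m - M) * of_int q powr (1 - m)"
      by (simp add: powr_add[symmetric])
    also have "\<dots> \<le> c * of_int q powr (1 - m)"
      using \<open>_ \<le> c\<close> by (intro mult_right_mono) auto
    also have "\<dots> \<le> \<bar>of_int q * \<xi> - of_int p\<bar>" using c(2)[of q p] q by simp
    also have "of_int q * \<xi> - of_int p = of_int q * (\<xi> - of_int p / of_int q)"
      using q by (simp add: field_simps)
    also have "\<bar>\<dots>\<bar> = of_int q * \<bar>\<xi> - of_int p / of_int q\<bar>" using q by (simp add: abs_mult)
    also have "\<dots> < of_int q * of_int q powr (- M)" using less q by simp
    also have "\<dots> = of_int q powr (1 - M)" using q by (simp add: powr_diff powr_minus field_simps)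
    finally show False by simp
  qed
  then show "irrationality_exponent \<xi> = \<infinity>"
    by (simp add: irrationality_exponent_eq_Inf top_ereal_def)
next
  assume inf: "irrationality_exponent \<xi> = \<infinity>"
  show "Liouville_number \<xi>"
    unfolding Liouville_number_def
  proof (intro allI impI)
    fix m :: real assume "m > 0"
    \<comment> \<open>Failure of the exponent \<open>m + 1\<close> gives only a weak inequality; the
      extra 1 makes it strict for \<open>m\<close>. Failure with threshold 2 provides
      \<open>q \<ge> 2\<close>.\<close>
    have "m + 1 \<notin> exponents \<xi>"
    proof
      assume "m + 1 \<in> exponents \<xi>"
      then have "irrationality_exponent \<xi> \<le> ereal (m + 1)"
        unfolding irrationality_exponent_eq_Inf by (simp add: Inf_lower)
      with inf show False by simp
    qed
    then have "\<not> (\<forall>p q::int. q \<ge> 2 \<longrightarrow> \<bar>\<xi> - of_int p / of_int q\<bar> > of_int q powr (- (m + 1)))"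
      unfolding exponents_def by blast
    then obtain p q :: int where q: "q \<ge> 2" "\<bar>\<xi> - of_int p / of_int q\<bar> \<le> of_int q powr (- (m + 1))"
      by (auto simp: not_less)
    have "of_int q powr (- (m + 1)) < of_int q powr (- m)" using q(1) by (intro powr_less_mono) auto
    with q(2) have "\<bar>\<xi> - of_int p / of_int q\<bar> < of_int q powr (- m)" by linarith
    with q(1) show "\<exists>p q::int. q \<ge> 2 \<and> \<bar>\<xi> - of_int p / of_int q\<bar> < of_int q powr (- m)"
      by blast
  qed
qed

theorem theorem4:
  fixes \<xi> :: real
  assumes "\<xi> \<notin> \<rat>"
  shows "tau3 \<xi> = tau2 \<xi> \<and> tau2 \<xi> = tau1 \<xi> \<and> tau1 \<xi> = tau0 \<xi> \<and>
         tau0 \<xi> = 1 / (irrationality_exponent \<xi> - 1) \<and>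
         1 / (irrationality_exponent \<xi> - 1) \<in> {0..1} \<and>
         (tau3 \<xi> = 0 \<longleftrightarrow> tau2 \<xi> = 0) \<and>
         (tau2 \<xi> = 0 \<longleftrightarrow> tau1 \<xi> = 0) \<and>
         (tau1 \<xi> = 0 \<longleftrightarrow> tau0 \<xi> = 0) \<and>
         (tau0 \<xi> = 0 \<longleftrightarrow> Liouville_number \<xi>)"
proof -
  let ?B = "1 / (irrationality_exponent \<xi> - 1)"
  have B: "?B \<in> {0..1}" "?B = 0 \<longleftrightarrow> Liouville_number \<xi>"
    unfolding Liouville_number_iff[OF assms]
    by (cases rule: irrationality_exponent_cases[OF assms]; force)+
  \<comment> \<open>Each of the four sets contains every positive real below \<open>?B\<close>,
    through \<open>T3_set\<close>, and nothing above \<open>?B\<close>, through dense forms.\<close>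
  have sup0: "sup0 S = ?B" if "T3_set \<xi> \<subseteq> S" "\<And>t. t \<in> S \<Longrightarrow> t > 0 \<and> dense_forms \<xi> t" for S
    using B(1) that T3_memberI_less[OF assms] dense_forms_le[OF assms]
    by (intro sup0_eqI) auto
  have "tau0 \<xi> = ?B"
    unfolding tau0_def
    using T3_subset_T0[OF assms] dense_forms_T0[OF assms] by (intro sup0) (auto simp: T0_set_def)
  moreover have "tau1 \<xi> = ?B"
    unfolding tau1_def
    using T3_subset_T1 dense_forms_T1 by (intro sup0) (auto simp: T1_set_def)
  moreover have "tau2 \<xi> = ?B"
    unfolding tau2_def
    using T3_subset_T2 dense_forms_T2 by (intro sup0) (auto simp: T2_set_def)
  moreover have "tau3 \<xi> = ?B"
    unfolding tau3_def
    using T3_subset_T2 dense_forms_T2 by (intro sup0) (auto simp: T3_set_def)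
  ultimately show ?thesis using B by simp
qed

end
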